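(* For positive integers $d,n$ let $F_d(n)$ denote the smallest positive integer $N$ such that every $d$-dimensional monotone array of size $N\times\cdots\times N$ contains a lex-monotone subarray of size $n\times\cdots\times n$. Then: (i) $F_2(n)=2n^2-5n+4$ for all positive integers $n$; (ii) for every $d\ge 3$, $F_d(n)\le 2^{O_d(n^{d-2})}$.
   Context: A $d$-dimensional array is an injective function $f\colon A_1\times\cdots\times A_d\to\mathbb{R}$, where $A_1,\dots,A_d$ are non-empty (finite) subsets of $\mathbb{Z}$; its size is $|A_1|\times\cdots\times|A_d|$. A subarray of $f$ is a restriction of $f$ to $B_1\times\cdots\times B_d$ with non-empty $B_i\subseteq A_i$. A $d$-dimensional array $f\colon A_1\times\cdots\times A_d\to\mathbb{R}$ is monotone if for each $i\in\{1,\dots,d\}$ one of the following holds: either $x\mapsto f(a_1,\dots,a_{i-1},x,a_{i+1},\dots,a_d)$ is increasing on $A_i$ for all choices of $a_j\in A_j$ ($j\ne i$), or it is decreasing on $A_i$ for all choices of $a_j\in A_j$ ($j\neq i$). For $\mathbf{u},\mathbf{v}\in\mathbb{R}^d$ write $\mathbf{u}<_{\mathrm{lex}}\mathbf{v}$ if $\mathbf{u}\ne\mathbf{v}$ and $u_i<v_i$, where $i$ is the smallest index with $u_i\ne v_i$. A $d$-dimensional array $f$ is lex-monotone if there exist a permutation $\sigma$ of $\{1,\dots,d\}$ and a sign vector $\mathbf{s}\in\{-1,1\}^d$ such that for all $\mathbf{x},\mathbf{y}$ in the domain of $f$, $$f(\mathbf{x})<f(\mathbf{y})\iff (s_{\sigma(1)}x_{\sigma(1)},\dots,s_{\sigma(d)}x_{\sigma(d)})<_{\mathrm{lex}}(s_{\sigma(1)}y_{\sigma(1)},\dots,s_{\sigma(d)}y_{\sigma(d)}).$$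 $O_d(n^{d-2})$ denotes a quantity bounded by $C\,n^{d-2}$ for all positive integers $n$, for some constant $C=C(d)$ depending only on $d$. *)

theory Defs
  imports Complex_Main "HOL-Library.FuncSet" "HOL-Combinatorics.Permutations"
begin

text \<open>
  A point of \<open>\<int>\<^sup>d\<close> is a function \<open>nat \<Rightarrow> int\<close> that is \<open>undefined\<close> outside \<open>{1..d}\<close>, so that the
  product \<open>A\<^sub>1 \<times> \<dots> \<times> A\<^sub>d\<close> is a dependent function space and \<open>d\<close> may be quantified over.
  An array is given by its side sets \<open>A\<close> together with \<open>f\<close>; only the values of \<open>A\<close> on \<open>{1..d}\<close>
  and of \<open>f\<close> on the grid matter.
\<close>

definition grid :: "nat \<Rightarrow> (nat \<Rightarrow> int set) \<Rightarrow> (nat \<Rightarrow> int) set" where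
  "grid d A = (\<Pi>\<^sub>E i\<in>{1..d}. A i)"

definition is_array :: "nat \<Rightarrow> (nat \<Rightarrow> int set) \<Rightarrow> ((nat \<Rightarrow> int) \<Rightarrow> real) \<Rightarrow> bool" where
  "is_array d A f \<longleftrightarrow>
     (\<forall>i\<in>{1..d}. finite (A i) \<and> A i \<noteq> {}) \<and> inj_on f (grid d A)"

definition cubic_size :: "nat \<Rightarrow> (nat \<Rightarrow> int set) \<Rightarrow> nat \<Rightarrow> bool" where
  "cubic_size d A n \<longleftrightarrow> (\<forall>i\<in>{1..d}. card (A i) = n)"

definition is_subarray ::
  "nat \<Rightarrow> (nat \<Rightarrow> int set) \<Rightarrow> ((nat \<Rightarrow> int) \<Rightarrow> real) \<Rightarrow>
   (nat \<Rightarrow> int set) \<Rightarrow> ((nat \<Rightarrow> int) \<Rightarrow> real) \<Rightarrow> bool" where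
  "is_subarray d B g A f \<longleftrightarrow>
     (\<forall>i\<in>{1..d}. B i \<noteq> {} \<and> B i \<subseteq> A i) \<and> g = restrict f (grid d B)"

text \<open>
  Quantifying over all \<open>a\<close> in the grid and overwriting its \<open>i\<close>-th coordinate amounts to
  quantifying over all choices of the coordinates other than the \<open>i\<close>-th.
\<close>

definition monotone_array :: "nat \<Rightarrow> (nat \<Rightarrow> int set) \<Rightarrow> ((nat \<Rightarrow> int) \<Rightarrow> real) \<Rightarrow> bool" where
  "monotone_array d A f \<longleftrightarrow>
     (\<forall>i\<in>{1..d}.
        (\<forall>a\<in>grid d A. strict_mono_on (A i) (\<lambda>x. f (a(i := x)))) \<or>
        (\<forall>a\<in>grid d A. strict_antimono_on (A i) (\<lambda>x. f (a(i := x)))))"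

definition lex_less :: "nat \<Rightarrow> (nat \<Rightarrow> 'a::linorder) \<Rightarrow> (nat \<Rightarrow> 'a) \<Rightarrow> bool" where
  "lex_less d u v \<longleftrightarrow> (\<exists>i\<in>{1..d}. (\<forall>j\<in>{1..<i}. u j = v j) \<and> u i < v i)"

definition lex_monotone :: "nat \<Rightarrow> (nat \<Rightarrow> int set) \<Rightarrow> ((nat \<Rightarrow> int) \<Rightarrow> real) \<Rightarrow> bool" where
  "lex_monotone d A f \<longleftrightarrow>
     (\<exists>\<sigma> s. \<sigma> permutes {1..d} \<and> (\<forall>i\<in>{1..d}. s i \<in> {-1, 1 :: int}) \<and>
        (\<forall>x\<in>grid d A. \<forall>y\<in>grid d A.
           f x < f y \<longleftrightarrow> lex_less d (\<lambda>i. s (\<sigma> i) * x (\<sigma> i)) (\<lambda>i. s (\<sigma> i) * y (\<sigma> i))))"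

definition forces_lex_monotone :: "nat \<Rightarrow> nat \<Rightarrow> nat \<Rightarrow> bool" where
  "forces_lex_monotone d n N \<longleftrightarrow>
     (\<forall>A f. is_array d A f \<and> cubic_size d A N \<and> monotone_array d A f \<longrightarrow>
        (\<exists>B g. is_subarray d B g A f \<and> cubic_size d B n \<and> lex_monotone d B g))"

text \<open>
  \<open>LEAST\<close> is meaningful only if some such \<open>N\<close> exists, which has to be proved alongside any
  claim about \<open>F\<close>.
\<close>

definition F :: "nat \<Rightarrow> nat \<Rightarrow> nat" where
  "F d n = (LEAST N. N \<ge> 1 \<and> forces_lex_monotone d n N)"

end

theory Submission
  imports Defs
begin

text \<open>
  Reflecting coordinates, one may assume that the array is increasing in every coordinate.

  For \<open>d = 2\<close> put \<open>w = n - 1\<close> and cut a square of side \<open>w (2 w - 1) + 1\<close> into \<open>(2 w - 1)\<^sup>2\<close> cells of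
  side \<open>w\<close>. Each cell says which of its two off-diagonal corners has the larger value, that is,
  which coordinate dominates there; counting yields \<open>w\<close> cells in one strip that agree in the
  direction needed for a lex-monotone subarray. Conversely, in a square of side \<open>w (2 w - 1)\<close> order
  the blocks of side \<open>w\<close> as a pinwheel around the central block, with two opposite arms ordered
  by rows and the other two by columns.

  For general \<open>d\<close> write coordinates with \<open>d\<close> digits in a large base \<open>q\<close>. Every point \<open>a\<close> has a ranking
  \<open>\<rho>\<close> of the coordinates such that a step of length \<open>q\<^sup>s\<close> in the coordinate of rank \<open>s\<close> raises
  the value at least as much as a step of length \<open>q\<^bsup>r + 1\<^esup>\<close> in the coordinate of any rank \<open>r < s\<close>. Some
  ranking occurs with density at least \<open>d\<^bsup>-d\<^esup>\<close>, so the density version of the box theorem, applied to digit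
  \<open>r\<close> of the coordinate of rank \<open>r\<close> for all \<open>r \<ge> 1\<close>, finds a large box of points with the same ranking.
  Only \<open>d - 1\<close> digits vary, because the lowest coordinate may run through a whole interval; this is why
  the exponent is \<open>d - 2\<close>.
\<close>

subsection \<open>Reduction to increasing arrays\<close>

text \<open>Points are arbitrary functions, so the first conjunct replaces extensionality by
  invariance outside \<open>I\<close>. The index set is a parameter because coordinates are later
  renamed from \<open>{1..d}\<close> to ranks in \<open>{..<d}\<close>.\<close>

definition grid_mono :: "nat set \<Rightarrow> nat \<Rightarrow> ((nat \<Rightarrow> nat) \<Rightarrow> real) \<Rightarrow> bool" where
  "grid_mono I N g \<longleftrightarrow>
     (\<forall>u v. (\<forall>i\<in>I. u i = v i) \<longrightarrow> g u = g v) \<and>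
     (\<forall>u v. (\<forall>i\<in>I. u i \<le> v i \<and> v i < N) \<and> (\<exists>i\<in>I. u i < v i) \<longrightarrow> g u < g v)"

definition grid_inj :: "nat set \<Rightarrow> nat \<Rightarrow> ((nat \<Rightarrow> nat) \<Rightarrow> real) \<Rightarrow> bool" where
  "grid_inj I N g \<longleftrightarrow>
     (\<forall>u v. (\<forall>i\<in>I. u i < N \<and> v i < N) \<and> g u = g v \<longrightarrow> (\<forall>i\<in>I. u i = v i))"

text \<open>One implication from lexicographic order to values suffices: points that differ are
  lexicographically comparable, so the converse follows. No signs occur because all coordinates
  increase.\<close>

definition grid_forces :: "nat \<Rightarrow> nat \<Rightarrow> nat \<Rightarrow> bool" where
  "grid_forces d n N \<longleftrightarrow>
     (\<forall>g. grid_mono {1..d} N g \<and> grid_inj {1..d} N g \<longrightarrow>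
        (\<exists>Y \<sigma>. \<sigma> permutes {1..d} \<and> (\<forall>i\<in>{1..d}. Y i \<subseteq> {..<N} \<and> card (Y i) = n) \<and>
           (\<forall>x y. (\<forall>i\<in>{1..d}. x i \<in> Y i \<and> y i \<in> Y i) \<and>
              lex_less d (\<lambda>i. x (\<sigma> i)) (\<lambda>i. y (\<sigma> i)) \<longrightarrow> g x < g y)))"

lemma grid_mono_cong:
  assumes "grid_mono I N g" "\<And>i. i \<in> I \<Longrightarrow> u i = v i"
  shows "g u = g v"
proof -
  have "(\<forall>i\<in>I. u i = v i) \<longrightarrow> g u = g v"
    by (rule conjunct1[OF assms(1)[unfolded grid_mono_def], THEN spec, THEN spec])
  then show ?thesis using assms(2) by simp
qed

lemma grid_mono_less:
  assumes "grid_mono I N g" "\<And>i. i \<in> I \<Longrightarrow> u i \<le> v i" "\<And>i. i \<in> I \<Longrightarrow> v i < N"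
    and "j \<in> I" "u j < v j"
  shows "g u < g v"
proof -
  have "(\<forall>i\<in>I. u i \<le> v i \<and> v i < N) \<and> (\<exists>i\<in>I. u i < v i) \<longrightarrow> g u < g v"
    by (rule conjunct2[OF assms(1)[unfolded grid_mono_def], THEN spec, THEN spec])
  then show ?thesis using assms(2-5) by blast
qed

lemma grid_mono_le:
  assumes "grid_mono I N g" "\<And>i. i \<in> I \<Longrightarrow> u i \<le> v i" "\<And>i. i \<in> I \<Longrightarrow> v i < N"
  shows "g u \<le> g v"
proof (cases "\<forall>i\<in>I. u i = v i")
  case True
  then show ?thesis using assms(1) unfolding grid_mono_def by (metis order_refl)
next
  case False
  then obtain j where "j \<in> I" "u j < v j" using assms(2) by (metis le_neq_implies_less)
  then show ?thesis using grid_mono_less[OF assms] by fastforce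
qed

text \<open>Passes from the one-coordinate form of \<open>monotone_array\<close> to comparison of
  whole points: walking from \<open>u\<close> to \<open>v\<close> coordinate by coordinate, each
  step weakly increases \<open>g\<close>, and the step at \<open>j\<close> does so strictly.\<close>

lemma grid_monoI:
  assumes dep: "\<And>u v. (\<forall>i\<in>{1..d}. u i = v i) \<Longrightarrow> g u = g v"
    and step: "\<And>u i t. i \<in> {1..d} \<Longrightarrow> (\<forall>j\<in>{1..d}. u j < N) \<Longrightarrow> u i < t \<Longrightarrow> t < N \<Longrightarrow>
                 g u < g (u(i := t))"
  shows "grid_mono {1..d} N g"
proof -
  have "g u < g v" if le: "\<forall>i\<in>{1..d}. u i \<le> v i \<and> v i < N" and j: "j \<in> {1..d}" "u j < v j" for u v j
  proof -
    define h where "h k = (\<lambda>i. if i \<le> k then v i else u i)" for k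
    have h_less: "\<forall>j\<in>{1..d}. h k j < N" for k
      unfolding h_def using le by (auto intro: le_less_trans)
    have Suc: "h (Suc k) = (h k)(Suc k := v (Suc k))" for k
      by (auto simp: h_def fun_eq_iff le_Suc_eq)
    have hS: "g (h k) \<le> g (h (Suc k))" "u (Suc k) < v (Suc k) \<Longrightarrow> g (h k) < g (h (Suc k))"
      if "Suc k \<le> d" for k
    proof -
      have k: "Suc k \<in> {1..d}" "h k (Suc k) = u (Suc k)" using that by (auto simp: h_def)
      show less: "g (h k) < g (h (Suc k))" if "u (Suc k) < v (Suc k)"
        unfolding Suc using step[OF k(1) h_less[of k]] k that le by simp
      show "g (h k) \<le> g (h (Suc k))"
      proof (cases "u (Suc k) < v (Suc k)")
        case False
        then have "h (Suc k) = h k" unfolding Suc using k le by (metis fun_upd_triv le_neq_implies_less)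
        then show ?thesis by simp
      qed (use less in simp)
    qed
    have "g u \<le> g (h k) \<and> (j \<le> k \<longrightarrow> g u < g (h k))" if "k \<le> d" for k
      using that
    proof (induction k)
      case 0
      have "g u = g (h 0)" by (rule dep) (auto simp: h_def)
      then show ?case using j by auto
    next
      case (Suc k)
      then show ?case using hS[of k] j by (cases "j = Suc k") auto
    qed
    from this[of d] j have "g u < g (h d)" by auto
    also have "g (h d) = g v" by (rule dep) (auto simp: h_def)
    finally show ?thesis .
  qed
  then show ?thesis unfolding grid_mono_def using dep by blast
qed

lemma lex_less_total:
  fixes x y :: "nat \<Rightarrow> 'a::linorder"
  assumes "\<sigma> permutes {1..d}" "i \<in> {1..d}" "x i \<noteq> y i"
  shows "lex_less d (\<lambda>i. x (\<sigma> i)) (\<lambda>i. y (\<sigma> i)) \<or> lex_less d (\<lambda>i. y (\<sigma> i)) (\<lambda>i. x (\<sigma> i))"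
proof -
  define P where "P k \<longleftrightarrow> k \<in> {1..d} \<and> x (\<sigma> k) \<noteq> y (\<sigma> k)" for k
  obtain k where "k \<in> {1..d}" "\<sigma> k = i" using assms by (metis permutes_image image_iff)
  then have "P k" using assms by (simp add: P_def)
  define m where "m = (LEAST k. P k)"
  have "P m" unfolding m_def by (rule LeastI) fact
  then have m: "m \<in> {1..d}" "x (\<sigma> m) < y (\<sigma> m) \<or> y (\<sigma> m) < x (\<sigma> m)"
    by (auto simp: P_def neq_iff)
  have "\<not> P j" if "j < m" for j using that not_less_Least unfolding m_def by blast
  then have "\<forall>j\<in>{1..<m}. x (\<sigma> j) = y (\<sigma> j)" using m(1) by (simp add: P_def)
  then show ?thesis unfolding lex_less_def using m by (metis (no_types, lifting))
qed

lemma lex_less_2: "lex_less 2 u v \<longleftrightarrow> u 1 < v 1 \<or> u 1 = v 1 \<and> u 2 < v 2"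
proof -
  have eq: "{1..2::nat} = {1, 2}" "{Suc 0..<2} = {Suc 0}" by auto
  show ?thesis unfolding lex_less_def eq(1) by (auto simp: eq(2))
qed

lemma bij_betw_strict_mono_finite:
  fixes M :: "'a::linorder set"
  assumes "finite M"
  obtains h where "bij_betw h {..<card M} M" "strict_mono_on {..<card M} h"
proof
  show "bij_betw (\<lambda>k. sorted_list_of_set M ! k) {..<card M} M"
    using assms by (intro bij_betw_nth) auto
  show "strict_mono_on {..<card M} (\<lambda>k. sorted_list_of_set M ! k)"
    by (intro strict_mono_onI sorted_wrt_nth_less[OF strict_sorted_list_of_set]) auto
qed

text \<open>Each side set is enumerated by \<open>0, ..., N - 1\<close>, in reverse order where
  \<open>f\<close> is not increasing. In these indices the array increases in every coordinate, and
  the sign vector \<open>s\<close> records the reversals.\<close>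

lemma grid_forces_imp_forces_lex_monotone:
  assumes "grid_forces d n N" "n \<ge> 1"
  shows "forces_lex_monotone d n N"
  unfolding forces_lex_monotone_def
proof (intro allI impI, elim conjE)
  fix A f assume arr: "is_array d A f" and cub: "cubic_size d A N" and mon: "monotone_array d A f"
  define inc where "inc i \<longleftrightarrow> (\<forall>a\<in>grid d A. strict_mono_on (A i) (\<lambda>x. f (a(i := x))))" for i
  define s :: "nat \<Rightarrow> int" where "s i = (if inc i then 1 else -1)" for i
  have "\<exists>h. bij_betw h {..<N} (A i) \<and> (\<forall>k<N. \<forall>l<N. k < l \<longleftrightarrow> s i * h k < s i * h l)"
    if i: "i \<in> {1..d}" for i
  proof -
    have "finite (A i)" "card (A i) = N"
      using arr cub i unfolding is_array_def cubic_size_def by auto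
    then obtain h where h: "bij_betw h {..<N} (A i)" "strict_mono_on {..<N} h"
      using bij_betw_strict_mono_finite[of "A i"] by metis
    have lt: "h k < h l \<longleftrightarrow> k < l" if "k < N" "l < N" for k l
      using h(2) that by (simp add: strict_mono_on_less)
    show ?thesis
    proof (cases "inc i")
      case True
      then show ?thesis using h lt by (auto intro!: exI[of _ h] simp: s_def)
    next
      case False
      have "bij_betw (\<lambda>k. N - 1 - k) {..<N} {..<N}"
        by (rule bij_betw_byWitness[where f' = "\<lambda>k. N - 1 - k"]) auto
      then have "bij_betw (h \<circ> (\<lambda>k. N - 1 - k)) {..<N} (A i)" using h bij_betw_trans by blast
      moreover have "k < l \<longleftrightarrow> s i * (h \<circ> (\<lambda>k. N - 1 - k)) k < s i * (h \<circ> (\<lambda>k. N - 1 - k)) l"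
        if "k < N" "l < N" for k l
        using that lt[of "N - 1 - l" "N - 1 - k"] False by (auto simp: s_def)
      ultimately show ?thesis by blast
    qed
  qed
  then obtain h where h: "\<And>i. i \<in> {1..d} \<Longrightarrow> bij_betw (h i) {..<N} (A i)"
    and h_less: "\<And>i k l. i \<in> {1..d} \<Longrightarrow> k < N \<Longrightarrow> l < N \<Longrightarrow> k < l \<longleftrightarrow> s i * h i k < s i * h i l"
    by metis
  define pt where "pt u = (\<lambda>i\<in>{1..d}. h i (u i))" for u
  define g where "g u = f (pt u)" for u
  have pt_grid: "pt u \<in> grid d A" if "\<forall>j\<in>{1..d}. u j < N" for u
    unfolding pt_def grid_def
  proof (rule restrict_PiE_iff[THEN iffD2], rule ballI)
    fix j assume "j \<in> {1..d}"
    then show "h j (u j) \<in> A j" using that h[of j] by (meson bij_betwE lessThan_iff)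
  qed
  have gm: "grid_mono {1..d} N g"
  proof (rule grid_monoI)
    show "g u = g v" if "\<forall>i\<in>{1..d}. u i = v i" for u v
    proof -
      have "pt u = pt v" unfolding pt_def by (rule restrict_ext) (use that in simp)
      then show ?thesis by (simp add: g_def)
    qed
    show "g u < g (u(i := t))"
      if i: "i \<in> {1..d}" and u: "\<forall>j\<in>{1..d}. u j < N" and t: "u i < t" "t < N" for u i t
    proof -
      have upd: "pt (u(i := t)) = (pt u)(i := h i t)" using i by (auto simp: pt_def fun_eq_iff)
      have same: "(pt u)(i := h i (u i)) = pt u" using i by (auto simp: pt_def fun_eq_iff)
      have hA: "h i t \<in> A i" "h i (u i) \<in> A i" using h[OF i] t by (auto simp: bij_betw_def)
      have lt: "s i * h i (u i) < s i * h i t" using h_less[OF i] t u i by auto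
      show ?thesis
      proof (cases "inc i")
        case True
        then have "strict_mono_on (A i) (\<lambda>x. f ((pt u)(i := x)))"
          using pt_grid[OF u] by (auto simp: inc_def)
        then have "f ((pt u)(i := h i (u i))) < f ((pt u)(i := h i t))"
          using hA lt True by (auto simp: s_def dest: strict_mono_onD)
        then show ?thesis unfolding g_def upd same .
      next
        case False
        then have "strict_antimono_on (A i) (\<lambda>x. f ((pt u)(i := x)))"
          using mon i pt_grid[OF u] unfolding monotone_array_def inc_def by blast
        then have "f ((pt u)(i := h i (u i))) < f ((pt u)(i := h i t))"
          using hA lt False by (auto simp: s_def monotone_on_def)
        then show ?thesis unfolding g_def upd same .
      qed
    qed
  qed
  have gi: "grid_inj {1..d} N g"
    unfolding grid_inj_def
  proof (intro allI impI ballI, elim conjE)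
    fix u v i assume uv: "\<forall>i\<in>{1..d}. u i < N \<and> v i < N" and "g u = g v" and i: "i \<in> {1..d}"
    then have "pt u = pt v"
      using arr pt_grid unfolding g_def is_array_def by (metis inj_onD)
    from fun_cong[OF this, of i] show "u i = v i"
      using i uv h[OF i] by (auto simp: pt_def bij_betw_def inj_on_def)
  qed
  from assms(1)[unfolded grid_forces_def, rule_format, OF conjI[OF gm gi]] obtain Y \<sigma>
    where \<sigma>: "\<sigma> permutes {1..d}"
      and Y': "\<forall>i\<in>{1..d}. Y i \<subseteq> {..<N} \<and> card (Y i) = n"
      and lex': "\<forall>x y. (\<forall>i\<in>{1..d}. x i \<in> Y i \<and> y i \<in> Y i) \<and>
                lex_less d (\<lambda>i. x (\<sigma> i)) (\<lambda>i. y (\<sigma> i)) \<longrightarrow> g x < g y"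
    by (elim exE conjE)
  have Y: "Y i \<subseteq> {..<N} \<and> card (Y i) = n" if "i \<in> {1..d}" for i
    using Y' that by (rule bspec)
  have lex: "g x < g y" if "\<forall>i\<in>{1..d}. x i \<in> Y i \<and> y i \<in> Y i"
    "lex_less d (\<lambda>i. x (\<sigma> i)) (\<lambda>i. y (\<sigma> i))" for x y
    using lex' that by (elim allE[of _ x] allE[of _ y]) simp
  define B where "B i = h i ` Y i" for i
  have \<sigma>_in: "\<sigma> i \<in> {1..d} \<longleftrightarrow> i \<in> {1..d}" for i using \<sigma> by (rule permutes_in_image)
  have inj: "inj_on (h i) (Y i)" if "i \<in> {1..d}" for i
    using h[OF that] Y[OF that] by (meson bij_betw_def inj_on_subset)
  have cardB: "card (B i) = n" if "i \<in> {1..d}" for i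
    using that by (simp add: B_def card_image inj Y)
  have "lex_monotone d B (restrict f (grid d B))"
    unfolding lex_monotone_def
  proof (intro exI[of _ \<sigma>] exI[of _ s] conjI ballI \<sigma>)
    show "s i \<in> {-1, 1}" for i by (simp add: s_def)
    fix x y assume xy: "x \<in> grid d B" "y \<in> grid d B"
    have pre: "\<exists>u. (\<forall>i\<in>{1..d}. u i \<in> Y i) \<and> x = pt u" if "x \<in> grid d B" for x
    proof -
      have "\<forall>i\<in>{1..d}. \<exists>k\<in>Y i. x i = h i k" using that unfolding grid_def B_def by fast
      then obtain u where u: "\<forall>i\<in>{1..d}. u i \<in> Y i \<and> x i = h i (u i)" by metis
      have "x i = pt u i" for i
        using u PiE_arb[OF that[unfolded grid_def], of i] by (cases "i \<in> {1..d}") (auto simp: pt_def)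
      then show ?thesis using u by blast
    qed
    obtain u where u: "\<forall>i\<in>{1..d}. u i \<in> Y i" "x = pt u" using pre xy by blast
    obtain v where v: "\<forall>i\<in>{1..d}. v i \<in> Y i" "y = pt v" using pre xy by blast
    have uN: "u i < N" "v i < N" if "i \<in> {1..d}" for i using u(1) v(1) Y that by blast+
    have mid: "s i * pt u i < s i * pt v i \<longleftrightarrow> u i < v i" "pt u i = pt v i \<longleftrightarrow> u i = v i"
      if "i \<in> {1..d}" for i
    proof -
      show "s i * pt u i < s i * pt v i \<longleftrightarrow> u i < v i"
        using h_less[OF that uN[OF that]] that by (simp add: pt_def)
      show "pt u i = pt v i \<longleftrightarrow> u i = v i"
        using h[OF that] uN[OF that] that by (auto simp: pt_def bij_betw_def inj_on_def)
    qed
    have s0: "s i \<noteq> 0" for i by (simp add: s_def)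
    have lex_eq: "lex_less d (\<lambda>i. s (\<sigma> i) * x (\<sigma> i)) (\<lambda>i. s (\<sigma> i) * y (\<sigma> i)) \<longleftrightarrow>
        lex_less d (\<lambda>i. u (\<sigma> i)) (\<lambda>i. v (\<sigma> i))"
      unfolding lex_less_def u(2) v(2)
    proof (intro bex_cong refl conj_cong ball_cong)
      fix i j assume "i \<in> {1..d}" "j \<in> {1..<i}"
      then have "\<sigma> j \<in> {1..d}" by (subst \<sigma>_in) auto
      then show "(s (\<sigma> j) * pt u (\<sigma> j) = s (\<sigma> j) * pt v (\<sigma> j)) = (u (\<sigma> j) = v (\<sigma> j))"
        using mid s0 by simp
    next
      fix i assume "i \<in> {1..d}"
      then show "(s (\<sigma> i) * pt u (\<sigma> i) < s (\<sigma> i) * pt v (\<sigma> i)) = (u (\<sigma> i) < v (\<sigma> i))"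
        using mid \<sigma>_in by blast
    qed
    \<comment> \<open>For the converse, \<open>g u < g v\<close> makes the points differ, so one
      precedes the other lexicographically; the wrong order would give
      \<open>g v < g u\<close>.\<close>
    have "g u < g v \<longleftrightarrow> lex_less d (\<lambda>i. u (\<sigma> i)) (\<lambda>i. v (\<sigma> i))"
    proof
      assume less: "g u < g v"
      then have "\<exists>i\<in>{1..d}. u i \<noteq> v i"
        using gm unfolding grid_mono_def by (metis less_irrefl)
      then show "lex_less d (\<lambda>i. u (\<sigma> i)) (\<lambda>i. v (\<sigma> i))"
        using lex_less_total[OF \<sigma>] lex[of v u] u v less by (metis less_asym)
    qed (use lex[of u v] u v in blast)
    then show "(restrict f (grid d B) x < restrict f (grid d B) y) =
      lex_less d (\<lambda>i. s (\<sigma> i) * x (\<sigma> i)) (\<lambda>i. s (\<sigma> i) * y (\<sigma> i))"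
      using xy lex_eq by (simp add: g_def u(2) v(2))
  qed
  moreover have "is_subarray d B (restrict f (grid d B)) A f"
    unfolding is_subarray_def
  proof (intro conjI ballI refl)
    fix i assume i: "i \<in> {1..d}"
    show "B i \<noteq> {}" using cardB[OF i] assms(2) by auto
    show "B i \<subseteq> A i" using h[OF i] Y[OF i] unfolding B_def bij_betw_def by blast
  qed
  moreover have "cubic_size d B n" unfolding cubic_size_def using cardB by blast
  ultimately show "\<exists>B g. is_subarray d B g A f \<and> cubic_size d B n \<and> lex_monotone d B g"
    by blast
qed

subsection \<open>Upper bound in dimension two\<close>

text \<open>Double counting with \<open>K = 2 * w - 1\<close>: otherwise each of the
  \<open>K\<close> columns and each of the \<open>K\<close> rows contributes at most
  \<open>w - 1\<close> cells, and \<open>2 * K * (w - 1) = K * (K - 1)\<close> is less than the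
  number \<open>K * K\<close> of all cells.\<close>

lemma majority_row_or_column:
  fixes P :: "nat \<Rightarrow> nat \<Rightarrow> bool"
  assumes "w \<ge> 1"
  shows "(\<exists>j<2*w-1. card {i. i < 2*w-1 \<and> P i j} \<ge> w) \<or> (\<exists>i<2*w-1. card {j. j < 2*w-1 \<and> \<not> P i j} \<ge> w)"
proof (rule ccontr)
  define K where "K = 2 * w - 1"
  assume neg: "\<not> ?thesis"
  have card_sum: "card {j. j < K \<and> Q j} = (\<Sum>j<K. if Q j then 1 else 0)" for Q
    by (simp add: sum.If_cases Int_def lessThan_def)
  have "(\<Sum>j<K. card {i. i < K \<and> P i j}) \<le> (\<Sum>j<K. w - 1)"
    using neg by (intro sum_mono) (force simp: K_def)
  moreover have "(\<Sum>i<K. card {j. j < K \<and> \<not> P i j}) \<le> (\<Sum>j<K. w - 1)"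
    using neg by (intro sum_mono) (force simp: K_def)
  moreover have "(\<Sum>j<K. card {i. i < K \<and> P i j}) + (\<Sum>i<K. card {j. j < K \<and> \<not> P i j})
      = (\<Sum>i<K. \<Sum>j<K. (if P i j then 1 else 0) + (if \<not> P i j then 1 else 0))"
    unfolding card_sum by (subst sum.swap) (simp add: sum.distrib)
  moreover have "\<dots> = (\<Sum>i<K. \<Sum>j<K. 1)" by (intro sum.cong) auto
  ultimately have "K * K \<le> K * (w - 1) + K * (w - 1)" by simp
  then have "K * K \<le> K * (2 * (w - 1))" by (simp add: algebra_simps)
  then show False using assms by (auto simp: K_def)
qed

text \<open>Here \<open>a\<close> is the dominant coordinate, and \<open>less\<close> says that it
  dominates in \<open>w\<close> cells of strip \<open>j\<close>. The other coordinate runs through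
  the full width of the strip. Keeping \<open>a\<close> variable covers both outcomes of the
  counting.\<close>

lemma strip_lex:
  fixes g :: "(nat \<Rightarrow> nat) \<Rightarrow> real"
  assumes gm: "grid_mono {1..2} (w * (2 * w - 1) + 1) g" and w: "w \<ge> 1"
    and ab: "{a, b} = {1, 2}" "a \<noteq> b"
    and j: "j < 2 * w - 1" and I: "I \<subseteq> {..<2*w-1}" "card I = w"
    and less: "\<And>i. i \<in> I \<Longrightarrow>
       g ((\<lambda>_. 0)(a := i * w, b := (j + 1) * w)) < g ((\<lambda>_. 0)(a := (i + 1) * w, b := j * w))"
  shows "\<exists>Y \<sigma>. \<sigma> permutes {1..2} \<and>
     (\<forall>i\<in>{1..2}. Y i \<subseteq> {..<w * (2 * w - 1) + 1} \<and> card (Y i) = w + 1) \<and>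
     (\<forall>x y. (\<forall>i\<in>{1..2}. x i \<in> Y i \<and> y i \<in> Y i) \<and>
        lex_less 2 (\<lambda>i. x (\<sigma> i)) (\<lambda>i. y (\<sigma> i)) \<longrightarrow> g x < g y)"
proof -
  define N where "N = w * (2 * w - 1) + 1"
  have ab': "a = 1 \<and> b = 2 \<or> a = 2 \<and> b = 1" using ab(1) by (metis doubleton_eq_iff)
  then have eq: "{1..2::nat} = {a, b}" by auto
  define \<sigma> where "\<sigma> = transpose 1 a"
  have \<sigma>: "\<sigma> permutes {1..2}" "\<sigma> 1 = a" "\<sigma> 2 = b"
    unfolding \<sigma>_def using ab' by (auto intro: permutes_swap_id)
  \<comment> \<open>The lower ends of the \<open>w\<close> chosen cells together with the upper end
    of the last one make \<open>w + 1\<close> values.\<close>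
  define rows where "rows = insert ((Max I + 1) * w) ((\<lambda>i. i * w) ` I)"
  have fin: "finite I" "I \<noteq> {}" using I w finite_subset by fastforce+
  have le_N: "i * w < N" if "i \<le> 2 * w - 1" for i
    unfolding N_def using mult_le_mono1[OF that, of w] unfolding mult.commute[of w "2 * w - 1"]
    by linarith
  have Suc_N: "(i + 1) * w < N" if "i < 2 * w - 1" for i
    by (rule le_N) (use that in simp)
  have MaxI: "Max I < 2 * w - 1" using fin I Max_in by blast
  have "(Max I + 1) * w \<notin> (\<lambda>i. i * w) ` I"
  proof
    assume "(Max I + 1) * w \<in> (\<lambda>i. i * w) ` I"
    then obtain i where "i \<in> I" "(Max I + 1) * w = i * w" by auto
    then have "Max I + 1 \<in> I" using w by (metis mult_right_cancel not_one_le_zero)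
    then show False using Max_ge[OF fin(1)] by fastforce
  qed
  moreover have "card ((\<lambda>i. i * w) ` I) = w"
    using I w by (subst card_image) (auto simp: inj_on_def)
  ultimately have rows: "card rows = w + 1" unfolding rows_def using fin by simp
  have rowsN: "rows \<subseteq> {..<N}"
    unfolding rows_def using I Suc_N[OF MaxI] le_N by (force simp del: add_mult_distrib)
  have colsN: "{j * w..(j + 1) * w} \<subseteq> {..<N}" using Suc_N[OF j] by auto
  \<comment> \<open>Between any two values in \<open>rows\<close> lies the whole chosen cell that
    starts at the smaller one.\<close>
  have gap: "\<exists>i\<in>I. s = i * w \<and> (i + 1) * w \<le> t" if st: "s \<in> rows" "t \<in> rows" "s < t" for s t
  proof -
    have t: "t \<le> (Max I + 1) * w"
    proof (cases "t = (Max I + 1) * w")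
      case False
      then obtain k where k: "k \<in> I" "t = k * w" using st(2) unfolding rows_def by auto
      show ?thesis unfolding k(2) by (rule mult_le_mono1) (use Max_ge[OF fin(1) k(1)] in linarith)
    qed simp
    then obtain i where i: "i \<in> I" "s = i * w" using st unfolding rows_def by auto
    have "(i + 1) * w \<le> t"
    proof (cases "t = (Max I + 1) * w")
      case True
      then show ?thesis using Max_ge[OF fin(1) i(1)] mult_le_mono1 by simp
    next
      case False
      then obtain k where k: "k \<in> I" "t = k * w" using st unfolding rows_def by auto
      then have "i < k" using i st by simp
      then have "(i + 1) * w \<le> k * w" by (intro mult_le_mono1) simp
      then show ?thesis using k by simp
    qed
    then show ?thesis using i by blast
  qed
  define Y where "Y = (\<lambda>_. {j * w..(j + 1) * w})(a := rows)"
  have Yab: "Y a = rows" "Y b = {j * w..(j + 1) * w}" using ab by (auto simp: Y_def)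
  have "g x < g y"
    if xy: "\<forall>i\<in>{1..2}. x i \<in> Y i \<and> y i \<in> Y i" and lex: "lex_less 2 (\<lambda>i. x (\<sigma> i)) (\<lambda>i. y (\<sigma> i))" for x y
  proof -
    have in_Y: "x a \<in> rows" "y a \<in> rows" "x b \<in> {j * w..(j + 1) * w}" "y b \<in> {j * w..(j + 1) * w}"
      using xy Yab unfolding eq by auto
    note gm = gm[folded N_def, unfolded eq]
    have yN: "y i < N" if "i \<in> {a, b}" for i using that in_Y rowsN colsN by auto
    show ?thesis
    proof (cases "x a < y a")
      case True
      obtain i where i: "i \<in> I" "x a = i * w" "(i + 1) * w \<le> y a" using gap in_Y True by blast
      have i': "i < 2 * w - 1" using i I by auto
      \<comment> \<open>The point \<open>x\<close> lies below one off-diagonal corner of the cell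
        and \<open>y\<close> above the other, so the comparison of these corners carries
        over.\<close>
      have "g x \<le> g ((\<lambda>_. 0)(a := i * w, b := (j + 1) * w))"
        by (rule grid_mono_le[OF gm]) (use i i' in_Y ab le_N[of i] Suc_N[OF j] in auto)
      also have "\<dots> < g ((\<lambda>_. 0)(a := (i + 1) * w, b := j * w))" by (rule less[OF i(1)])
      also have "\<dots> \<le> g y"
        by (rule grid_mono_le[OF gm]) (use i in_Y ab yN in auto)
      finally show ?thesis .
    next
      case False
      then have "x a = y a" "x b < y b" using lex \<sigma> by (auto simp: lex_less_2)
      then show ?thesis by (intro grid_mono_less[OF gm _ yN, where j = b]) auto
    qed
  qed
  moreover have "\<forall>i\<in>{1..2}. Y i \<subseteq> {..<N} \<and> card (Y i) = w + 1"
    unfolding eq using Yab rows rowsN colsN by auto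
  ultimately show ?thesis unfolding N_def using \<sigma>(1) by blast
qed

lemma grid_forces_2:
  assumes "n \<ge> 1"
  shows "grid_forces 2 n ((n - 1) * (2 * n - 3) + 1)"
  unfolding grid_forces_def
proof (intro allI impI, elim conjE)
  fix g :: "(nat \<Rightarrow> nat) \<Rightarrow> real"
  define w where "w = n - 1"
  assume gm0: "grid_mono {1..2} ((n - 1) * (2 * n - 3) + 1) g"
    and gi0: "grid_inj {1..2} ((n - 1) * (2 * n - 3) + 1) g"
  show "\<exists>Y \<sigma>. \<sigma> permutes {1..2} \<and>
     (\<forall>i\<in>{1..2}. Y i \<subseteq> {..<(n - 1) * (2 * n - 3) + 1} \<and> card (Y i) = n) \<and>
     (\<forall>x y. (\<forall>i\<in>{1..2}. x i \<in> Y i \<and> y i \<in> Y i) \<and>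
        lex_less 2 (\<lambda>i. x (\<sigma> i)) (\<lambda>i. y (\<sigma> i)) \<longrightarrow> g x < g y)"
  \<comment> \<open>A single point has to be treated apart, since cells of side \<open>w = 0\<close>
    are degenerate.\<close>
  proof (cases "n = 1")
    case True
    have "\<not> lex_less 2 (\<lambda>i. x (id i)) (\<lambda>i. y (id i))"
      if "\<forall>i\<in>{1..2}. x i \<in> {0::nat} \<and> y i \<in> {0::nat}" for x y
      using that by (simp add: lex_less_2)
    then show ?thesis using True
      by (intro exI[of _ "\<lambda>_. {0}"] exI[of _ id] conjI permutes_id) auto
  next
    case False
    then have w: "w \<ge> 1" "n = w + 1" using assms by (auto simp: w_def)
    then have N: "(n - 1) * (2 * n - 3) + 1 = w * (2 * w - 1) + 1" by simp
    note gm = gm0[unfolded N] and gi = gi0[unfolded N]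
    define q :: "nat \<Rightarrow> nat \<Rightarrow> nat \<Rightarrow> nat"
      where "q i j = (\<lambda>_. 0)(1 := i * w, 2 := j * w)" for i j
    define P where "P i j \<longleftrightarrow> g (q i (j + 1)) < g (q (i + 1) j)" for i j
    \<comment> \<open>Injectivity excludes ties, so coordinate 2 dominates strictly in every cell
      where coordinate 1 does not.\<close>
    have flip: "g (q (i + 1) j) < g (q i (j + 1))"
      if "\<not> P i j" "i < 2 * w - 1" "j < 2 * w - 1" for i j
    proof -
      have le: "k * w < w * (2 * w - 1) + 1" if "k \<le> 2 * w - 1" for k
        using mult_le_mono1[OF that, of w] unfolding mult.commute[of w "2 * w - 1"] by linarith
      have "g (q (i + 1) j) \<noteq> g (q i (j + 1))"
      proof
        assume "g (q (i + 1) j) = g (q i (j + 1))"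
        moreover have "\<forall>k\<in>{1..2}. q (i + 1) j k < w * (2 * w - 1) + 1 \<and>
            q i (j + 1) k < w * (2 * w - 1) + 1"
          unfolding q_def using le[of i] le[of j] le[of "i + 1"] le[of "j + 1"] that by simp
        ultimately have "q (i + 1) j 1 = q i (j + 1) 1"
          using gi unfolding grid_inj_def by fastforce
        then show False using w by (simp add: q_def)
      qed
      then show ?thesis using that unfolding P_def by linarith
    qed
    from majority_row_or_column[OF w(1), of P] show ?thesis
    proof (elim disjE exE conjE)
      fix j assume j: "j < 2*w-1" "w \<le> card {i. i < 2*w-1 \<and> P i j}"
      from obtain_subset_with_card_n[OF j(2)] obtain I
        where I: "I \<subseteq> {i. i < 2*w-1 \<and> P i j}" "card I = w" by blast
      show ?thesis unfolding N unfolding w(2)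
        by (rule strip_lex[OF gm w(1) _ _ j(1) _ I(2), of 1 2])
          (use I in \<open>auto simp: P_def q_def\<close>)
    next
      fix i assume i: "i < 2*w-1" "w \<le> card {j. j < 2*w-1 \<and> \<not> P i j}"
      from obtain_subset_with_card_n[OF i(2)] obtain J
        where J: "J \<subseteq> {j. j < 2*w-1 \<and> \<not> P i j}" "card J = w" by blast
      have sw: "(\<lambda>_. 0)(2 := y * w, 1 := x * w) = q x y" for x y
        unfolding q_def by (rule fun_upd_twist) simp
      show ?thesis unfolding N unfolding w(2)
      proof (rule strip_lex[OF gm w(1) _ _ i(1) _ J(2), of 2 1])
        show "g ((\<lambda>_. 0)(2 := j * w, 1 := (i + 1) * w)) < g ((\<lambda>_. 0)(2 := (j + 1) * w, 1 := i * w))"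
          if "j \<in> J" for j
          unfolding sw using flip[of i j] J i that by blast
      qed (use J in auto)
    qed
  qed
qed

subsection \<open>Lower bound in dimension two\<close>

text \<open>
  Four arms around the central block \<open>(w - 1, w - 1)\<close>; for \<open>w = 2\<close> the \<open>3 \<times> 3\<close> blocks have the relative
  order \<open>1 2 6 / 3 5 7 / 4 8 9\<close>.
\<close>

definition block_key :: "int \<Rightarrow> int \<Rightarrow> int \<Rightarrow> int" where
  "block_key w a b =
     (let K = 2 * w - 1; rowwise = a * K + b; colwise = b * K + a in
      if a \<le> w - 2 \<and> b \<le> w - 1 then rowwise
      else if b \<le> w - 2 then K\<^sup>2 + colwise
      else if a = w - 1 \<and> b = w - 1 then 2 * K\<^sup>2
      else if a \<le> w - 1 then 3 * K\<^sup>2 + colwise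
      else 4 * K\<^sup>2 + rowwise)"

lemma pair_key_bounds:
  fixes a b K :: int
  assumes "0 \<le> a" "a < K" "0 \<le> b" "b < K"
  shows "0 \<le> a * K + b" "a * K + b < K\<^sup>2"
proof -
  show "0 \<le> a * K + b" using assms by simp
  have "(a + 1) * K \<le> K * K" using assms by (intro mult_right_mono) auto
  then show "a * K + b < K\<^sup>2" using assms by (simp add: power2_eq_square algebra_simps)
qed

lemma pair_key_less:
  fixes a b a' b' K :: int
  assumes "0 \<le> b" "0 \<le> b'" "b < K" "a < a' \<or> a = a' \<and> b < b'"
  shows "a * K + b < a' * K + b'"
proof (cases "a < a'")
  case True
  have "(a + 1) * K \<le> a' * K"
    using assms True by (intro mult_right_mono) auto
  then show ?thesis using assms by (simp add: algebra_simps)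
qed (use assms in auto)

text \<open>Increasing a coordinate never leads back to an earlier arm. Multiples of
  \<open>K\<^sup>2\<close> separate the arms, since pair keys lie between \<open>0\<close> and
  \<open>K\<^sup>2\<close>; inside an arm the pair key itself increases.\<close>

lemma block_key_mono:
  assumes "0 \<le> a" "a \<le> a'" "a' < 2 * w - 1" "0 \<le> b" "b \<le> b'" "b' < 2 * w - 1" "a < a' \<or> b < b'"
  shows "block_key w a b < block_key w a' b'"
proof -
  define K where "K = 2 * w - 1"
  \<comment> \<open>Abbreviating the square leaves a linear case analysis once the bounds on the
    pair keys are supplied.\<close>
  define Q where "Q = K\<^sup>2"
  have "a * K + b < a' * K + b'" "b * K + a < b' * K + a'"
    using assms by (auto intro!: pair_key_less simp: K_def)
  moreover have "0 \<le> a * K + b" "a * K + b < Q" "0 \<le> a' * K + b'" "a' * K + b' < Q"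
     "0 \<le> b * K + a" "b * K + a < Q" "0 \<le> b' * K + a'" "b' * K + a' < Q"
    unfolding Q_def by (rule pair_key_bounds; use assms in \<open>simp add: K_def\<close>)+
  ultimately show ?thesis
    unfolding block_key_def Let_def K_def[symmetric] Q_def[symmetric]
    using assms by (smt (verit))
qed

text \<open>The last premise says that the first coordinate dominates on a rectangle of blocks. The
  point is that the side of the centre to which the rows are confined depends on \<open>b'\<close>
  alone, so it is the same for all pairs of rows.\<close>

lemma block_key_columns:
  assumes "0 \<le> a" "a < a'" "a' < 2 * w - 1" "0 \<le> b" "b < b'" "b' < 2 * w - 1"
    and "block_key w a b' \<le> block_key w a' b"
  shows "if b' \<le> w - 1 then a \<le> w - 2 else a' \<ge> w"
proof -
  define K where "K = 2 * w - 1"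
  define Q where "Q = K\<^sup>2"
  have "b * K + a' < b' * K + a"
    using assms by (intro pair_key_less) (auto simp: K_def)
  moreover have "0 \<le> a * K + b'" "a * K + b' < Q" "0 \<le> a' * K + b" "a' * K + b < Q"
     "0 \<le> b * K + a'" "b * K + a' < Q" "0 \<le> b' * K + a" "b' * K + a < Q"
    unfolding Q_def by (rule pair_key_bounds; use assms in \<open>simp add: K_def\<close>)+
  ultimately show ?thesis
    using assms unfolding block_key_def Let_def K_def[symmetric] Q_def[symmetric]
    by (smt (verit))
qed

text \<open>The counterpart for dominance of the second coordinate. The two sides trade places
  because the other pair of arms is now the obstacle.\<close>

lemma block_key_rows:
  assumes "0 \<le> a" "a < a'" "a' < 2 * w - 1" "0 \<le> b" "b < b'" "b' < 2 * w - 1"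
    and "block_key w a' b \<le> block_key w a b'"
  shows "if a' \<le> w - 1 then b' \<ge> w else b \<le> w - 2"
proof -
  define K where "K = 2 * w - 1"
  define Q where "Q = K\<^sup>2"
  have "a * K + b' < a' * K + b"
    using assms by (intro pair_key_less) (auto simp: K_def)
  moreover have "0 \<le> a * K + b'" "a * K + b' < Q" "0 \<le> a' * K + b" "a' * K + b < Q"
     "0 \<le> b * K + a'" "b * K + a' < Q" "0 \<le> b' * K + a" "b' * K + a < Q"
    unfolding Q_def by (rule pair_key_bounds; use assms in \<open>simp add: K_def\<close>)+
  ultimately show ?thesis
    using assms unfolding block_key_def Let_def K_def[symmetric] Q_def[symmetric]
    by (smt (verit))
qed

lemma block_key_inj:
  assumes "block_key w a b = block_key w a' b'"
    and "0 \<le> a" "a < 2 * w - 1" "0 \<le> b" "b < 2 * w - 1"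
    and "0 \<le> a'" "a' < 2 * w - 1" "0 \<le> b'" "b' < 2 * w - 1"
  shows "a = a' \<and> b = b'"
proof -
  define K where "K = 2 * w - 1"
  define Q where "Q = K\<^sup>2"
  have inj: "x = x' \<and> y = y'" if "x * K + y = x' * K + y'" "0 \<le> y" "y < K" "0 \<le> y'" "y' < K"
    for x y x' y' :: int
    using that pair_key_less[of y y' K x x'] pair_key_less[of y' y K x' x]
    by (metis linorder_neqE less_irrefl)
  have "a * K + b = a' * K + b' \<Longrightarrow> ?thesis" "b * K + a = b' * K + a' \<Longrightarrow> ?thesis"
    using inj assms unfolding K_def by blast+
  moreover have "0 \<le> a * K + b" "a * K + b < Q" "0 \<le> a' * K + b'" "a' * K + b' < Q"
     "0 \<le> b * K + a" "b * K + a < Q" "0 \<le> b' * K + a'" "b' * K + a' < Q"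
    unfolding Q_def by (rule pair_key_bounds; use assms in \<open>simp add: K_def\<close>)+
  ultimately show ?thesis
    using assms unfolding block_key_def Let_def K_def[symmetric] Q_def[symmetric]
    by (smt (verit))
qed

text \<open>The block key decides first, because the offset inside a block is below
  \<open>w\<^sup>2\<close>. The offset orders each block by rows, which keeps the array increasing
  and injective.\<close>

definition block_val :: "int \<Rightarrow> int \<Rightarrow> int \<Rightarrow> int" where
  "block_val w x y = block_key w (x div w) (y div w) * w\<^sup>2 + (x mod w * w + y mod w)"

lemma div_less_blocks:
  fixes x w :: int
  assumes "w \<ge> 1" "0 \<le> x" "x < w * (2 * w - 1)"
  shows "0 \<le> x div w" "x div w < 2 * w - 1"
proof -
  show "0 \<le> x div w" using assms by (simp add: pos_imp_zdiv_nonneg_iff)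
  have "w * (x div w) \<le> x" using assms mult_div_mod_eq[of w x] pos_mod_sign[of w x] by linarith
  then have "w * (x div w) < w * (2 * w - 1)" using assms by linarith
  then show "x div w < 2 * w - 1" using assms by (simp add: mult_less_cancel_left)
qed

lemma block_val_key_le:
  assumes "w \<ge> 1" "block_val w x y \<le> block_val w x' y'"
  shows "block_key w (x div w) (y div w) \<le> block_key w (x' div w) (y' div w)"
proof (rule ccontr)
  assume "\<not> ?thesis"
  then have "(block_key w (x' div w) (y' div w) + 1) * w\<^sup>2 \<le> block_key w (x div w) (y div w) * w\<^sup>2"
    by (intro mult_right_mono) auto
  moreover have "0 \<le> x mod w * w + y mod w" "x' mod w * w + y' mod w < w\<^sup>2"
    using pair_key_bounds[of "x mod w" w "y mod w"] pair_key_bounds[of "x' mod w" w "y' mod w"] assms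
    by auto
  ultimately show False using assms(2) unfolding block_val_def ring_distribs mult_1_left by linarith
qed

lemma block_val_mono:
  assumes "w \<ge> 1" "0 \<le> x" "x \<le> x'" "x' < w * (2 * w - 1)"
    and "0 \<le> y" "y \<le> y'" "y' < w * (2 * w - 1)" "x < x' \<or> y < y'"
  shows "block_val w x y < block_val w x' y'"
proof (cases "x div w = x' div w \<and> y div w = y' div w")
  case True
  then have "x mod w \<le> x' mod w" "y mod w \<le> y' mod w" "x mod w < x' mod w \<or> y mod w < y' mod w"
    using assms by (auto simp: minus_mult_div_eq_mod[symmetric])
  then have "x mod w * w + y mod w < x' mod w * w + y' mod w"
    using assms by (intro pair_key_less) auto
  then show ?thesis unfolding block_val_def using True by simp
next
  case False
  have le: "x div w \<le> x' div w" "y div w \<le> y' div w" using assms by (auto intro: zdiv_mono1)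
  have "block_key w (x div w) (y div w) < block_key w (x' div w) (y' div w)"
    by (rule block_key_mono) (use False le assms div_less_blocks[of w] in \<open>auto simp: less_le\<close>)
  then show ?thesis using block_val_key_le[OF assms(1), of x' y' x y] by linarith
qed

lemma block_val_inj:
  assumes "w \<ge> 1" "block_val w x y = block_val w x' y'"
    and "x \<in> {0..<w * (2 * w - 1)}" "y \<in> {0..<w * (2 * w - 1)}"
    and "x' \<in> {0..<w * (2 * w - 1)}" "y' \<in> {0..<w * (2 * w - 1)}"
  shows "x = x' \<and> y = y'"
proof -
  have "block_key w (x div w) (y div w) = block_key w (x' div w) (y' div w)"
    using block_val_key_le assms by (metis order_antisym order_refl)
  then have div: "x div w = x' div w \<and> y div w = y' div w"
    by (rule block_key_inj) (use assms div_less_blocks[of w] in auto)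
  then have eq: "x mod w * w + y mod w = x' mod w * w + y' mod w"
    using assms(2) unfolding block_val_def by simp
  have b: "0 \<le> y mod w" "y mod w < w" "0 \<le> y' mod w" "y' mod w < w" using assms(1) by auto
  have "x mod w = x' mod w \<and> y mod w = y' mod w"
    using eq pair_key_less[OF b(1,3,2), of "x mod w" "x' mod w"]
      pair_key_less[OF b(3,1,4), of "x' mod w" "x mod w"]
    by (metis linorder_neqE less_irrefl)
  then show ?thesis using div by (metis mult_div_mod_eq)
qed

section \<open>Size of lex-monotone subarrays of the pinwheel\<close>

text \<open>All elements except the largest, respectively the smallest, lie in an interval of
  \<open>w - 1\<close> integers.\<close>

lemma card_le_if_one_sided:
  fixes S :: "int set"
  assumes S: "S \<subseteq> {0..2 * w - 2}" and w: "w \<ge> 1"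
    and "(\<forall>a\<in>S. \<forall>a'\<in>S. a < a' \<longrightarrow> a \<le> w - 2) \<or> (\<forall>a\<in>S. \<forall>a'\<in>S. a < a' \<longrightarrow> a' \<ge> w)"
  shows "int (card S) \<le> w"
proof (cases "S = {}")
  case False
  have fin: "finite S" using S finite_subset by blast
  note m = Min_in[OF fin False] Max_in[OF fin False] Min_le[OF fin] Max_ge[OF fin]
  have card: "card S = card (S - {z}) + 1" if "z \<in> S" for z
    using card_Suc_Diff1[OF fin that] by simp
  from assms(3) have "\<exists>z\<in>S. S - {z} \<subseteq> {0..w - 2} \<or> S - {z} \<subseteq> {w..2 * w - 2}"
  proof
    assume le: "\<forall>a\<in>S. \<forall>a'\<in>S. a < a' \<longrightarrow> a \<le> w - 2"
    have "S - {Max S} \<subseteq> {0..w - 2}"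
    proof
      fix a assume a: "a \<in> S - {Max S}"
      then have "a < Max S" using m(4)[of a] by (simp add: less_le)
      then show "a \<in> {0..w - 2}" using le m(2) a S by auto
    qed
    then show ?thesis using m(2) by blast
  next
    assume le: "\<forall>a\<in>S. \<forall>a'\<in>S. a < a' \<longrightarrow> a' \<ge> w"
    have "S - {Min S} \<subseteq> {w..2 * w - 2}"
    proof
      fix a assume a: "a \<in> S - {Min S}"
      then have "Min S < a" using m(3)[of a] by (simp add: less_le)
      then show "a \<in> {w..2 * w - 2}" using le m(1) a S by auto
    qed
    then show ?thesis using m(1) by blast
  qed
  then obtain z where "z \<in> S" "S - {z} \<subseteq> {0..w - 2} \<or> S - {z} \<subseteq> {w..2 * w - 2}" by blast
  then have "card (S - {z}) \<le> nat (w - 1)"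
    using card_mono[of "{0..w - 2}" "S - {z}"] card_mono[of "{w..2 * w - 2}" "S - {z}"] by auto
  then show ?thesis using card[OF \<open>z \<in> S\<close>] w by simp
qed (use w in simp)

text \<open>\<open>P\<close> holds the values of the dominant coordinate and \<open>Q\<close> those
  of the other; abstract \<open>v\<close> and \<open>\<kappa>\<close> allow either coordinate to
  dominate. The extremes of \<open>Q\<close> are at least \<open>w\<close> apart, hence in different
  blocks. Two elements of \<open>P\<close> in one block would then contradict \<open>mono\<close>,
  so \<open>P\<close> meets \<open>w + 1\<close> blocks, whereas \<open>sided\<close> leaves room
  for \<open>w\<close> only.\<close>

lemma no_long_dominating_chain:
  fixes \<kappa> v :: "int \<Rightarrow> int \<Rightarrow> int"
  assumes w: "w \<ge> 1"
    and key: "\<And>x y x' y'. v x y \<le> v x' y' \<Longrightarrow> \<kappa> (x div w) (y div w) \<le> \<kappa> (x' div w) (y' div w)"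
    and mono: "\<And>a b b'. 0 \<le> a \<Longrightarrow> a < 2 * w - 1 \<Longrightarrow> 0 \<le> b \<Longrightarrow> b < b' \<Longrightarrow> b' < 2 * w - 1 \<Longrightarrow>
        \<kappa> a b < \<kappa> a b'"
    and sided: "\<And>b b'. 0 \<le> b \<Longrightarrow> b < b' \<Longrightarrow> b' < 2 * w - 1 \<Longrightarrow>
       (\<forall>a a'. 0 \<le> a \<and> a < a' \<and> a' < 2 * w - 1 \<and> \<kappa> a b' \<le> \<kappa> a' b \<longrightarrow> a \<le> w - 2) \<or>
       (\<forall>a a'. 0 \<le> a \<and> a < a' \<and> a' < 2 * w - 1 \<and> \<kappa> a b' \<le> \<kappa> a' b \<longrightarrow> a' \<ge> w)"
    and P: "P \<subseteq> {0..<w * (2 * w - 1)}" "int (card P) = w + 1"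
    and Q: "Q \<subseteq> {0..<w * (2 * w - 1)}" "int (card Q) = w + 1"
    and less: "\<And>p p' q q'. p \<in> P \<Longrightarrow> p' \<in> P \<Longrightarrow> p < p' \<Longrightarrow> q \<in> Q \<Longrightarrow> q' \<in> Q \<Longrightarrow> v p q' \<le> v p' q"
  shows False
proof -
  have fin: "finite Q" "Q \<noteq> {}" using Q w finite_subset by fastforce+
  define q q' where "q = Min Q" "q' = Max Q"
  have q: "q \<in> Q" "q' \<in> Q" "Q \<subseteq> {q..q'}" using fin by (auto simp: q_q'_def)
  have "w + 1 \<le> int (card {q..q'})" using card_mono[OF finite_atLeastAtMost_int q(3)] Q by linarith
  then have "q + w \<le> q'" using w by (auto split: if_splits)
  then have "(q + w) div w \<le> q' div w" using w by (intro zdiv_mono1) auto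
  then have "q div w < q' div w" using w by simp
  moreover have "0 \<le> q div w" "q' div w < 2 * w - 1" using q Q div_less_blocks[OF w] by auto
  ultimately have b: "0 \<le> q div w" "q div w < q' div w" "q' div w < 2 * w - 1" by auto
  have range: "0 \<le> p div w" "p div w < 2 * w - 1" if "p \<in> P" for p
    using P that div_less_blocks[OF w] by auto
  have chain: "p div w < p' div w \<and> \<kappa> (p div w) (q' div w) \<le> \<kappa> (p' div w) (q div w)"
    if "p \<in> P" "p' \<in> P" "p < p'" for p p'
  proof -
    have le: "\<kappa> (p div w) (q' div w) \<le> \<kappa> (p' div w) (q div w)" by (rule key, rule less) (use that q in auto)
    have "p div w \<noteq> p' div w" using le mono[OF range[OF that(1)] b] by auto
    moreover have "p div w \<le> p' div w" using that w by (intro zdiv_mono1) auto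
    ultimately show ?thesis using le by simp
  qed
  define S where "S = (\<lambda>p. p div w) ` P"
  have "inj_on (\<lambda>p. p div w) P"
    by (rule inj_onI) (metis chain less_irrefl linorder_neqE)
  then have "card S = card P" unfolding S_def by (rule card_image)
  moreover have ch: "\<kappa> a (q' div w) \<le> \<kappa> a' (q div w)" if aa: "a \<in> S" "a' \<in> S" "a < a'" for a a'
  proof -
    obtain p p' where p: "p \<in> P" "p' \<in> P" "a = p div w" "a' = p' div w" using aa unfolding S_def by auto
    then have "p < p'" using aa w by (metis linorder_not_le zdiv_mono1 zero_less_one less_le_trans)
    then show ?thesis using chain p by simp
  qed
  moreover have S: "0 \<le> a \<and> a < 2 * w - 1" if "a \<in> S" for a using that range unfolding S_def by auto
  moreover have "int (card S) \<le> w"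
    using sided[OF b] ch S by (intro card_le_if_one_sided[OF _ w]) (fastforce, meson)
  ultimately show False using P by simp
qed

text \<open>The counterexample is the pinwheel restricted to a corner square of side
  \<open>N\<close>. All \<open>N\<close> up to \<open>w * (2 * w - 1)\<close> are covered because
  minimality of \<open>F\<close> has to be checked at each of them.\<close>

lemma not_forces_2:
  assumes w: "w \<ge> 1" and N: "N \<ge> 1" "int N \<le> int w * (2 * int w - 1)"
  shows "\<not> forces_lex_monotone 2 (w + 1) N"
proof
  assume F: "forces_lex_monotone 2 (w + 1) N"
  define v where "v = block_val (int w)"
  define f :: "(nat \<Rightarrow> int) \<Rightarrow> real" where "f x = real_of_int (v (x 1) (x 2))" for x
  define A :: "nat \<Rightarrow> int set" where "A = (\<lambda>_. {0..<int N})"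
  have eq: "{1..2::nat} = {1, 2}" by auto
  have w': "int w \<ge> 1" using w by simp
  have inA: "x 1 \<in> {0..<int w * (2 * int w - 1)} \<and> x 2 \<in> {0..<int w * (2 * int w - 1)}"
    if "x \<in> grid 2 A" for x
  proof -
    have "x 1 \<in> A 1" "x 2 \<in> A 2" using that unfolding grid_def by auto
    then show ?thesis using N by (auto simp: A_def)
  qed
  have "is_array 2 A f"
    unfolding is_array_def
  proof (intro conjI ballI inj_onI)
    show "finite (A i)" "A i \<noteq> {}" for i using N by (auto simp: A_def)
    fix x y assume xy: "x \<in> grid 2 A" "y \<in> grid 2 A" "f x = f y"
    have "x 1 = y 1 \<and> x 2 = y 2"
      using xy inA by (intro block_val_inj[OF w']) (auto simp: f_def v_def)
    then show "x = y"
      using xy(1,2) unfolding grid_def by (intro PiE_ext[of x _ A y]) (auto simp only: eq)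
  qed
  moreover have "cubic_size 2 A N" by (simp add: cubic_size_def A_def)
  moreover have "monotone_array 2 A f"
    unfolding monotone_array_def
  proof (intro ballI disjI1 strict_mono_onI)
    fix i a x y assume i: "i \<in> {1..2::nat}" and a: "a \<in> grid 2 A" and xy: "x \<in> A i" "y \<in> A i" "x < y"
    have "x \<ge> 0" "y < int w * (2 * int w - 1)" using xy N by (auto simp: A_def)
    then show "f (a(i := x)) < f (a(i := y))"
      using i inA[OF a] xy(3) unfolding eq f_def v_def
      by (auto intro!: block_val_mono[OF w'])
  qed
  ultimately obtain B g where B: "is_subarray 2 B g A f" "cubic_size 2 B (w + 1)" "lex_monotone 2 B g"
    using F unfolding forces_lex_monotone_def by blast
  then obtain \<sigma> s where \<sigma>: "\<sigma> permutes {1..2}" and s: "\<forall>i\<in>{1..2}. s i \<in> {-1, 1 :: int}"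
    and lex: "\<forall>x\<in>grid 2 B. \<forall>y\<in>grid 2 B.
      g x < g y \<longleftrightarrow> lex_less 2 (\<lambda>i. s (\<sigma> i) * x (\<sigma> i)) (\<lambda>i. s (\<sigma> i) * y (\<sigma> i))"
    unfolding lex_monotone_def by blast
  have sub: "B i \<subseteq> {0..<int w * (2 * int w - 1)}" "int (card (B i)) = int w + 1" if "i \<in> {1, 2}" for i
  proof -
    have "B i \<subseteq> A i" using B(1) that unfolding is_subarray_def eq by blast
    then show "B i \<subseteq> {0..<int w * (2 * int w - 1)}" using N by (auto simp: A_def)
    show "int (card (B i)) = int w + 1" using B(2) that unfolding cubic_size_def eq by auto
  qed
  define pt :: "int \<Rightarrow> int \<Rightarrow> nat \<Rightarrow> int" where "pt p q = (\<lambda>i\<in>{1..2}. if i = \<sigma> 1 then p else q)" for p q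
  have \<sigma>12: "\<sigma> 1 = 1 \<and> \<sigma> 2 = 2 \<or> \<sigma> 1 = 2 \<and> \<sigma> 2 = 1"
    using permutes_in_image[OF \<sigma>, of 1] permutes_in_image[OF \<sigma>, of 2]
      inj_eq[OF permutes_inj[OF \<sigma>], of 1 2]
    unfolding eq by auto
  have less: "f (pt p q') < f (pt p' q)"
    if pq: "p \<in> B (\<sigma> 1)" "p' \<in> B (\<sigma> 1)" "p < p'" "q \<in> B (\<sigma> 2)" "q' \<in> B (\<sigma> 2)" for p p' q q'
  proof -
    have "pt x y \<in> grid 2 B" if "x \<in> B (\<sigma> 1)" "y \<in> B (\<sigma> 2)" for x y
      unfolding grid_def pt_def
    proof (rule restrict_PiE_iff[THEN iffD2], rule ballI)
      fix i assume "i \<in> {1..2::nat}"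
      then have "i = \<sigma> 1 \<or> i = \<sigma> 2" using \<sigma>12 by auto
      then show "(if i = \<sigma> 1 then x else y) \<in> B i" using that by auto
    qed
    then have grid: "pt p q \<in> grid 2 B" "pt p' q \<in> grid 2 B" "pt p q' \<in> grid 2 B"
      using pq by blast+
    have g: "g = restrict f (grid 2 B)" using B(1) unfolding is_subarray_def by blast
    have lex': "f x < f y \<longleftrightarrow> s (\<sigma> 1) * x (\<sigma> 1) < s (\<sigma> 1) * y (\<sigma> 1) \<or>
         s (\<sigma> 1) * x (\<sigma> 1) = s (\<sigma> 1) * y (\<sigma> 1) \<and> s (\<sigma> 2) * x (\<sigma> 2) < s (\<sigma> 2) * y (\<sigma> 2)"
      if "x \<in> grid 2 B" "y \<in> grid 2 B" for x y
      using lex that by (simp add: lex_less_2 g)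
    have ppt: "pt x y (\<sigma> 1) = x" "pt x y (\<sigma> 2) = y" for x y using \<sigma>12 by (auto simp: pt_def)
    have \<sigma>B: "B (\<sigma> 1) \<subseteq> {0..<int w * (2 * int w - 1)}" "B (\<sigma> 2) \<subseteq> {0..<int w * (2 * int w - 1)}"
      using \<sigma>12 by (auto intro!: sub(1))
    have range: "0 \<le> p" "p' < int w * (2 * int w - 1)" "0 \<le> q" "q < int w * (2 * int w - 1)"
      using \<sigma>B pq by auto
    \<comment> \<open>The array increases in both coordinates, so comparing two points that differ
      in coordinate \<open>\<sigma> 1\<close> only shows that its sign is positive. The two
      inequalities serve the two possible values of \<open>\<sigma> 1\<close>.\<close>
    have "block_val w p q < block_val w p' q" "block_val w q p < block_val w q p'"
      using range pq(3) by (auto intro!: block_val_mono[OF w'])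
    then have "f (pt p q) < f (pt p' q)"
      using \<sigma>12 unfolding f_def v_def pt_def by auto
    then have "s (\<sigma> 1) * p < s (\<sigma> 1) * p'" unfolding lex'[OF grid(1,2)] ppt by simp
    then show ?thesis unfolding lex'[OF grid(3,2)] ppt by simp
  qed
  from \<sigma>12 show False
  proof
    assume \<sigma>1: "\<sigma> 1 = 1 \<and> \<sigma> 2 = 2"
    show False
    proof (rule no_long_dominating_chain[OF w', of v "block_key (int w)" "B 1" "B 2"])
      show "v p q' \<le> v p' q" if "p \<in> B 1" "p' \<in> B 1" "p < p'" "q \<in> B 2" "q' \<in> B 2" for p p' q q'
        using less[of p p' q q'] that \<sigma>1 by (simp add: f_def pt_def)
      show "(\<forall>a a'. 0 \<le> a \<and> a < a' \<and> a' < 2 * int w - 1 \<and>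
             block_key (int w) a b' \<le> block_key (int w) a' b \<longrightarrow> a \<le> int w - 2) \<or>
           (\<forall>a a'. 0 \<le> a \<and> a < a' \<and> a' < 2 * int w - 1 \<and>
             block_key (int w) a b' \<le> block_key (int w) a' b \<longrightarrow> int w \<le> a')"
        if "0 \<le> b" "b < b'" "b' < 2 * int w - 1" for b b'
        using block_key_columns[of _ _ "int w" b b'] that by (cases "b' \<le> int w - 1") auto
    qed (use sub block_val_key_le[OF w'] block_key_mono in \<open>auto simp: v_def\<close>)
  next
    assume \<sigma>2: "\<sigma> 1 = 2 \<and> \<sigma> 2 = 1"
    show False
    proof (rule no_long_dominating_chain[OF w', of "\<lambda>x y. v y x" "\<lambda>a b. block_key (int w) b a" "B 2" "B 1"])
      show "v q' p \<le> v q p'" if "p \<in> B 2" "p' \<in> B 2" "p < p'" "q \<in> B 1" "q' \<in> B 1" for p p' q q'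
        using less[of p p' q q'] that \<sigma>2 by (simp add: f_def pt_def)
      show "(\<forall>a a'. 0 \<le> a \<and> a < a' \<and> a' < 2 * int w - 1 \<and>
             block_key (int w) b' a \<le> block_key (int w) b a' \<longrightarrow> a \<le> int w - 2) \<or>
           (\<forall>a a'. 0 \<le> a \<and> a < a' \<and> a' < 2 * int w - 1 \<and>
             block_key (int w) b' a \<le> block_key (int w) b a' \<longrightarrow> int w \<le> a')"
        if "0 \<le> b" "b < b'" "b' < 2 * int w - 1" for b b'
        using block_key_rows[of b b' "int w"] that by (cases "b' \<le> int w - 1") auto
    qed (use sub block_val_key_le[OF w'] block_key_mono in \<open>auto simp: v_def\<close>)
  qed
qed

subsection \<open>Boxes in dense sets\<close>

lemma popular_value:
  fixes f :: "'a \<Rightarrow> nat"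
  assumes "finite A" "x * card A \<le> (\<Sum>a\<in>A. f a)" "A \<noteq> {}"
  shows "\<exists>a\<in>A. x \<le> f a"
proof (rule ccontr)
  assume "\<not> ?thesis"
  then have "(\<Sum>a\<in>A. f a) < (\<Sum>a\<in>A. x)" using assms by (intro sum_strict_mono) auto
  then show False using assms by (simp add: mult.commute)
qed

lemma card_pairs_swap:
  assumes "finite A" "finite B"
  shows "(\<Sum>x\<in>A. card {y \<in> B. R x y}) = (\<Sum>y\<in>B. card {x \<in> A. R x y})"
proof -
  have "(\<Sum>x\<in>A. card {y \<in> B. R x y}) = (\<Sum>x\<in>A. \<Sum>y\<in>B. if R x y then 1 else 0)"
    using assms by (intro sum.cong) (auto simp: sum.If_cases Int_def)
  also have "\<dots> = (\<Sum>y\<in>B. \<Sum>x\<in>A. if R x y then 1 else 0)" by (rule sum.swap)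
  also have "\<dots> = (\<Sum>y\<in>B. card {x \<in> A. R x y})"
    using assms by (intro sum.cong) (auto simp: sum.If_cases Int_def)
  finally show ?thesis .
qed

text \<open>
  Points of \<open>U\<close> with at least half the average number of neighbours make up a positive proportion;
  among these the common neighbours are picked one at a time, each costing a factor \<open>4 C\<close>.
\<close>

lemma common_neighbours:
  fixes U :: "'a set"
  assumes fin: "finite U" and ne: "U \<noteq> {}" and q: "4 * C * m \<le> q" "q \<ge> 1" and C: "C \<ge> 1"
    and dense: "card U * q \<le> C * (\<Sum>x\<in>U. card {y. y < q \<and> R x y})"
  shows "\<exists>Y U'. Y \<subseteq> {..<q} \<and> card Y = m \<and> U' \<subseteq> U \<and> card U \<le> (4 * C) ^ (m + 1) * card U' \<and>
           (\<forall>x\<in>U'. \<forall>y\<in>Y. R x y)"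
proof -
  define N where "N x = {y. y < q \<and> R x y}" for x
  have finN: "finite (N x)" "card (N x) \<le> q" for x
  proof -
    have "N x \<subseteq> {..<q}" by (auto simp: N_def)
    then show "finite (N x)" "card (N x) \<le> q"
      using finite_subset card_mono[of "{..<q}" "N x"] by auto
  qed
  define U0 where "U0 = {x \<in> U. q \<le> 2 * C * card (N x)}"
  have U0: "finite U0" "U0 \<subseteq> U" using fin by (auto simp: U0_def)
  have "2 * (card U * q) \<le> (\<Sum>x\<in>U. 2 * C * card (N x))"
    using dense by (simp add: N_def sum_distrib_left[symmetric] mult.assoc)
  also have "\<dots> \<le> (\<Sum>x\<in>U. q + (if x \<in> U0 then 2 * C * q else 0))"
  proof (rule sum_mono)
    fix x assume "x \<in> U"
    have "2 * C * card (N x) \<le> 2 * C * q" by (rule mult_le_mono2) (rule finN)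
    then show "2 * C * card (N x) \<le> q + (if x \<in> U0 then 2 * C * q else 0)"
      using \<open>x \<in> U\<close> unfolding U0_def by (cases "q \<le> 2 * C * card (N x)") (simp_all only: mem_Collect_eq if_True if_False simp_thms)
  qed
  also have "\<dots> = card U * q + card U0 * (2 * C * q)"
  proof -
    have "U \<inter> U0 = U0" using U0 by blast
    then show ?thesis using fin by (simp add: sum.distrib sum.If_cases)
  qed
  finally have "card U * q \<le> (2 * C * card U0) * q" by (simp add: algebra_simps)
  then have U_le: "card U \<le> 2 * C * card U0" using q by simp
  have "\<exists>Y U'. Y \<subseteq> {..<q} \<and> card Y = k \<and> U' \<subseteq> U0 \<and> card U0 \<le> (4 * C) ^ k * card U' \<and>
           (\<forall>x\<in>U'. \<forall>y\<in>Y. R x y)" if "k \<le> m" for k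
    using that
  proof (induction k)
    case 0
    show ?case by (intro exI[of _ "{}"] exI[of _ U0]) auto
  next
    case (Suc k)
    then obtain Y U' where Y: "Y \<subseteq> {..<q}" "card Y = k" and U': "U' \<subseteq> U0"
      and card: "card U0 \<le> (4 * C) ^ k * card U'" and R: "\<forall>x\<in>U'. \<forall>y\<in>Y. R x y"
      by auto
    have fin': "finite U'" "finite Y" using U' U0 Y finite_subset by blast+
    have "card U > 0" using fin ne by (simp add: card_gt_0_iff)
    then have "card U' > 0" using card U_le by (metis mult_0_right le_zero_eq not_gr_zero)
    have "4 * C * k + 4 * C \<le> q"
      using q(1) Suc.prems mult_le_mono2[of "Suc k" m "4 * C"] by simp
    \<comment> \<open>Points of \<open>U0\<close> have at least \<open>q / (2 * C)\<close>
      neighbours. The \<open>k\<close> values already picked number at most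
      \<open>q / (4 * C)\<close>, so at least \<open>q / (4 * C)\<close> neighbours remain.\<close>
    have nb: "q \<le> 4 * C * card {y \<in> {..<q} - Y. R x y}" if "x \<in> U'" for x
    proof -
      have "q \<le> 2 * C * card (N x)" using that U' by (auto simp: U0_def)
      also have "\<dots> \<le> 2 * C * (card (N x - Y) + k)"
        using Y(2) fin' finN diff_card_le_card_Diff[of Y "N x"] by (intro mult_le_mono2) simp
      finally have "q \<le> 2 * C * card (N x - Y) + 2 * C * k" by (simp add: algebra_simps)
      moreover have "2 * (2 * C * k) \<le> q" using \<open>4 * C * k + 4 * C \<le> q\<close> by simp
      ultimately have "q \<le> 2 * (2 * C * card (N x - Y))" by linarith
      moreover have "N x - Y = {y \<in> {..<q} - Y. R x y}" by (auto simp: N_def)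
      ultimately show ?thesis by simp
    qed
    have "card ({..<q} - Y) \<le> q" "card ({..<q} - Y) = q - k"
      using Y fin' by (simp_all add: card_Diff_subset)
    have "card U' * card ({..<q} - Y) \<le> card U' * q"
      using \<open>card ({..<q} - Y) \<le> q\<close> by simp
    also have "\<dots> \<le> (\<Sum>x\<in>U'. 4 * C * card {y \<in> {..<q} - Y. R x y})"
      using sum_mono[of U' "\<lambda>_. q"] nb by simp
    also have "\<dots> = (\<Sum>y\<in>{..<q} - Y. 4 * C * card {x \<in> U'. R x y})"
      using fin' by (simp add: sum_distrib_left[symmetric] card_pairs_swap)
    finally have sum: "card U' * card ({..<q} - Y) \<le> (\<Sum>y\<in>{..<q} - Y. 4 * C * card {x \<in> U'. R x y})" .
    have "k < q"
    proof -
      have "1 * k \<le> 4 * C * k" by (rule mult_le_mono1) (use C in linarith)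
      then show ?thesis using \<open>4 * C * k + 4 * C \<le> q\<close> C by linarith
    qed
    then have "{..<q} - Y \<noteq> {}"
      using \<open>card ({..<q} - Y) = q - k\<close> by (metis card.empty zero_less_diff less_irrefl)
    from popular_value[OF _ sum this] obtain y
      where y: "y < q" "y \<notin> Y" "card U' \<le> 4 * C * card {x \<in> U'. R x y}" by auto
    have "card U0 \<le> (4 * C) ^ k * (4 * C * card {x \<in> U'. R x y})"
      using card y(3) by (meson le_trans mult_le_mono2)
    then show ?case using Y y U' R fin'
      by (intro exI[of _ "insert y Y"] exI[of _ "{x \<in> U'. R x y}"]) (auto simp: algebra_simps)
  qed
  from this[of m] obtain Y U' where Y: "Y \<subseteq> {..<q}" "card Y = m" and U': "U' \<subseteq> U0"
      and card: "card U0 \<le> (4 * C) ^ m * card U'" and R: "\<forall>x\<in>U'. \<forall>y\<in>Y. R x y"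
    by auto
  note U_le
  \<comment> \<open>The factor \<open>2 * C\<close> lost in passing to \<open>U0\<close> is weakened
    to \<open>4 * C\<close>, so that the total loss is a pure power.\<close>
  also have "2 * C * card U0 \<le> 4 * C * ((4 * C) ^ m * card U')"
    by (rule mult_le_mono) (use card in auto)
  finally have "card U \<le> 4 * C * ((4 * C) ^ m * card U')" .
  then show ?thesis using Y U' R U0
    by (intro exI[of _ Y] exI[of _ U']) (auto simp: algebra_simps)
qed

text \<open>Bounds the inverse density after \<open>k\<close> coordinates have received their
  \<open>m\<close> values, starting from \<open>C\<close>: one use of
  \<open>common_neighbours\<close> turns \<open>C\<close> into
  \<open>(4 * C) ^ (m + 1)\<close>.\<close>

primrec box_const :: "nat \<Rightarrow> nat \<Rightarrow> nat \<Rightarrow> nat" where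
  "box_const m 0 C = C"
| "box_const m (Suc k) C = box_const m k ((4 * C) ^ (m + 1))"

text \<open>Induction over the varying coordinates. \<open>S\<close> is read as a bipartite graph
  between assignments of the remaining coordinates and values at \<open>k\<close>; common neighbours
  \<open>Y\<close> form the side at \<open>k\<close>, and the induction continues in the dense set
  \<open>U'\<close>. Once \<open>K\<close> is exhausted, any surviving point supplies the constants
  \<open>u\<close>.\<close>

lemma dense_contains_box:
  fixes K R :: "'a set"
  assumes "finite K" "finite R" "K \<inter> R = {}"
    and "S \<subseteq> (K \<union> R) \<rightarrow>\<^sub>E {..<q}" "q ^ card (K \<union> R) \<le> C * card S"
    and "\<And>i. i < card K \<Longrightarrow> 4 * box_const m i C * m \<le> q" and "q \<ge> 1" "C \<ge> 1"
  shows "\<exists>X u. (\<forall>k\<in>K. X k \<subseteq> {..<q} \<and> card (X k) = m) \<and> (\<forall>r\<in>R. u r < q) \<and>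
     (\<forall>w\<in>extensional (K \<union> R). (\<forall>k\<in>K. w k \<in> X k) \<and> (\<forall>r\<in>R. w r = u r) \<longrightarrow> w \<in> S)"
  using assms(1,3-6,8)
proof (induction K arbitrary: S C rule: finite_induct)
  case empty
  have "q ^ card R > 0" using \<open>q \<ge> 1\<close> by simp
  then have "card S > 0" using empty.prems by (cases "card S") auto
  then obtain s where s: "s \<in> S" by (metis card_gt_0_iff ex_in_conv)
  have sR: "s \<in> R \<rightarrow>\<^sub>E {..<q}" using s empty.prems by auto
  have "w = s" if "w \<in> extensional R" "\<forall>r\<in>R. w r = s r" for w
    using that sR by (intro extensionalityI[of w R s]) (auto simp: PiE_def)
  then show ?case using s sR by (intro exI[of _ "\<lambda>_. {}"] exI[of _ s]) auto
next
  case (insert k K)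
  define U where "U = (K \<union> R) \<rightarrow>\<^sub>E {..<q}"
  have kR: "k \<notin> K \<union> R" "finite (K \<union> R)" using insert assms(2) by auto
  have U: "finite U" "card U = q ^ card (K \<union> R)"
    unfolding U_def using kR by (auto simp: card_PiE intro!: finite_PiE)
  have "U \<noteq> {}" using U \<open>q \<ge> 1\<close> by (metis card.empty not_one_le_zero one_le_power)
  define Rel where "Rel x y \<longleftrightarrow> x(k := y) \<in> S" for x y
  have "S \<subseteq> (\<lambda>(x, y). x(k := y)) ` (SIGMA x:U. {y. y < q \<and> Rel x y})"
  proof
    fix s assume s: "s \<in> S"
    then have "s \<in> insert k (K \<union> R) \<rightarrow>\<^sub>E {..<q}" using insert.prems by auto
    then have "s(k := undefined) \<in> U" "s k < q"
      unfolding U_def using kR by (auto simp: PiE_def extensional_def)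
    moreover have "(s(k := undefined))(k := s k) = s" by simp
    ultimately show "s \<in> (\<lambda>(x, y). x(k := y)) ` (SIGMA x:U. {y. y < q \<and> Rel x y})"
      using s unfolding Rel_def by (intro image_eqI[of _ _ "(s(k := undefined), s k)"]) auto
  qed
  then have "card S \<le> card (SIGMA x:U. {y. y < q \<and> Rel x y})"
    using U by (intro surj_card_le) auto
  also have "\<dots> = (\<Sum>x\<in>U. card {y. y < q \<and> Rel x y})" using U by (intro card_SigmaI) auto
  finally have "C * card S \<le> C * (\<Sum>x\<in>U. card {y. y < q \<and> Rel x y})" by simp
  moreover have "card U * q \<le> C * card S"
    using insert.prems(3) kR U by (simp add: mult.commute)
  ultimately have dense: "card U * q \<le> C * (\<Sum>x\<in>U. card {y. y < q \<and> Rel x y})" by linarith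
  have "4 * C * m \<le> q" using insert.prems(4)[of 0] insert.hyps by simp
  from common_neighbours[OF U(1) \<open>U \<noteq> {}\<close> this \<open>q \<ge> 1\<close> \<open>C \<ge> 1\<close> dense]
  obtain Y U' where Y: "Y \<subseteq> {..<q}" "card Y = m" and U': "U' \<subseteq> U"
    "card U \<le> (4 * C) ^ (m + 1) * card U'" and Rel: "\<forall>x\<in>U'. \<forall>y\<in>Y. Rel x y"
    by blast
  have "\<exists>X u. (\<forall>k\<in>K. X k \<subseteq> {..<q} \<and> card (X k) = m) \<and> (\<forall>r\<in>R. u r < q) \<and>
     (\<forall>w\<in>extensional (K \<union> R). (\<forall>k\<in>K. w k \<in> X k) \<and> (\<forall>r\<in>R. w r = u r) \<longrightarrow> w \<in> U')"
  proof (rule insert.IH)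
    show "K \<inter> R = {}" using insert.prems by auto
    show "U' \<subseteq> K \<union> R \<rightarrow>\<^sub>E {..<q}" using U' by (simp add: U_def)
    show "q ^ card (K \<union> R) \<le> (4 * C) ^ (m + 1) * card U'" using U' U by simp
    show "4 * box_const m i ((4 * C) ^ (m + 1)) * m \<le> q" if "i < card K" for i
      using insert.prems(4)[of "Suc i"] insert.hyps that by simp
    show "1 \<le> (4 * C) ^ (m + 1)" using \<open>C \<ge> 1\<close> by (intro one_le_power) simp
  qed
  then obtain X u where X: "\<forall>k\<in>K. X k \<subseteq> {..<q} \<and> card (X k) = m" and u: "\<forall>r\<in>R. u r < q"
    and w: "\<And>w. w \<in> extensional (K \<union> R) \<Longrightarrow> \<forall>k\<in>K. w k \<in> X k \<Longrightarrow> \<forall>r\<in>R. w r = u r \<Longrightarrow> w \<in> U'"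
    by blast
  have "w \<in> S" if w': "w \<in> extensional (insert k K \<union> R)"
    "\<forall>j\<in>insert k K. w j \<in> (X(k := Y)) j" "\<forall>r\<in>R. w r = u r" for w
  proof -
    have "w(k := undefined) \<in> U'"
      using w' kR by (intro w) (auto simp: extensional_def)
    then have "Rel (w(k := undefined)) (w k)" using Rel w'(2) by simp
    then show ?thesis by (simp add: Rel_def)
  qed
  then show ?case using X Y u kR by (intro exI[of _ "X(k := Y)"] exI[of _ u]) auto
qed

text \<open>Each step multiplies the exponent by at most \<open>m + 2\<close>, since
  \<open>2 + c * (m + 1) \<le> c * (m + 2)\<close> for \<open>c \<ge> 2\<close>.\<close>

lemma box_const_le:
  assumes "4 * C \<le> 2 ^ c" "c \<ge> 2"
  shows "4 * box_const m i C \<le> 2 ^ (c * (m + 2) ^ i)"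
  using assms
proof (induction i arbitrary: C c)
  case (Suc i)
  have "4 * (4 * C) ^ (m + 1) \<le> 2 ^ 2 * (2 ^ c) ^ (m + 1)"
    using Suc.prems by (intro mult_le_mono power_mono) auto
  also have "\<dots> = 2 ^ (2 + c * (m + 1))" by (simp only: power_add power_mult)
  also have "\<dots> \<le> 2 ^ (c * (m + 2))" using Suc.prems by (intro power_increasing) auto
  finally have "4 * box_const m i ((4 * C) ^ (m + 1)) \<le> 2 ^ (c * (m + 2) * (m + 2) ^ i)"
    by (rule Suc.IH) (use Suc.prems in simp)
  then show ?case by (simp only: box_const.simps power_Suc mult.assoc)
qed simp

section \<open>Ranking the coordinates by the effect of their steps\<close>

text \<open>The index \<open>j0\<close> with the least value at level \<open>L + 1\<close> gets rank
  0. By monotonicity in the level it stays below all others at higher levels, and the rest is ranked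
  from level \<open>L + 1\<close> on.\<close>

lemma greedy_order:
  fixes v :: "'a \<Rightarrow> nat \<Rightarrow> real"
  assumes "finite J" "card J = k"
    and "\<And>j l l'. j \<in> J \<Longrightarrow> l \<le> l' \<Longrightarrow> l' \<le> L + k \<Longrightarrow> v j l \<le> v j l'"
  shows "\<exists>\<rho>. bij_betw \<rho> {..<k} J \<and>
     (\<forall>r r'. r < r' \<and> r' < k \<longrightarrow> v (\<rho> r) (L + r + 1) \<le> v (\<rho> r') (L + r'))"
  using assms
proof (induction k arbitrary: J L)
  case 0
  then show ?case by (auto simp: bij_betw_def)
next
  case (Suc k)
  then have "J \<noteq> {}" by auto
  then obtain j0 where j0: "j0 \<in> J" "\<forall>j\<in>J. v j0 (L + 1) \<le> v j (L + 1)"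
    using ex_is_arg_min_if_finite[OF Suc.prems(1), of "\<lambda>j. v j (L + 1)"]
    by (auto simp: is_arg_min_linorder)
  have "\<exists>\<rho>. bij_betw \<rho> {..<k} (J - {j0}) \<and>
     (\<forall>r r'. r < r' \<and> r' < k \<longrightarrow> v (\<rho> r) (Suc L + r + 1) \<le> v (\<rho> r') (Suc L + r'))"
    using Suc.prems j0 by (intro Suc.IH) auto
  then obtain \<rho> where \<rho>: "bij_betw \<rho> {..<k} (J - {j0})"
    and order: "\<And>r r'. r < r' \<Longrightarrow> r' < k \<Longrightarrow> v (\<rho> r) (Suc L + r + 1) \<le> v (\<rho> r') (Suc L + r')"
    by blast
  define \<rho>' where "\<rho>' = case_nat j0 \<rho>"
  have "bij_betw \<rho>' {..<Suc k} J"
  proof -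
    have "bij_betw (\<rho>' \<circ> Suc) {..<k} (J - {j0})" using \<rho> by (simp add: \<rho>'_def comp_def)
    then have "bij_betw \<rho>' (Suc ` {..<k}) (J - {j0})"
      by (simp add: bij_betw_comp_iff2 inj_on_def bij_betw_def inj_on_image_iff image_comp comp_inj_on_iff)
    moreover have "bij_betw \<rho>' {0} {j0}" by (simp add: \<rho>'_def bij_betw_def)
    ultimately have "bij_betw \<rho>' ({0} \<union> Suc ` {..<k}) ({j0} \<union> (J - {j0}))"
      by (intro bij_betw_combine) auto
    moreover have "{0} \<union> Suc ` {..<k} = {..<Suc k}" by (simp add: lessThan_Suc_eq_insert_0)
    moreover have "{j0} \<union> (J - {j0}) = J" using j0 by auto
    ultimately show ?thesis by simp
  qed
  moreover have "v (\<rho>' r) (L + r + 1) \<le> v (\<rho>' r') (L + r')" if rr: "r < r'" "r' < Suc k" for r r'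
  proof -
    obtain s' where s': "r' = Suc s'" "s' < k" using rr by (metis Suc_less_eq less_imp_Suc_add)
    have in_J: "\<rho> s' \<in> J" using \<rho> s' by (auto simp: bij_betw_def)
    show ?thesis
    proof (cases r)
      case 0
      have "v j0 (L + 1) \<le> v (\<rho> s') (L + 1)" using j0 in_J by blast
      also have "\<dots> \<le> v (\<rho> s') (L + r')" using s' rr in_J by (intro Suc.prems(3)) auto
      finally show ?thesis using 0 s' by (simp add: \<rho>'_def)
    next
      case (Suc s)
      then show ?thesis using order[of s s'] rr s' by (simp add: \<rho>'_def)
    qed
  qed
  ultimately show ?case by blast
qed

subsection \<open>Arbitrary dimension\<close>

lemma digit_sum_less:
  fixes q :: nat
  assumes "\<And>r. r < d \<Longrightarrow> t r < q"
  shows "(\<Sum>r<d. t r * q ^ r) < q ^ d"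
  using assms
proof (induction d)
  case (Suc d)
  have "(\<Sum>r<d. t r * q ^ r) < q ^ d" using Suc by simp
  moreover have "(t d + 1) * q ^ d \<le> q * q ^ d" using Suc.prems[of d] by (intro mult_le_mono1) simp
  ultimately show ?case by simp
qed simp

lemma grid_mono_reindex:
  assumes gm: "grid_mono J N g" and \<rho>: "bij_betw \<rho> I J"
  shows "grid_mono I N (\<lambda>w. g (\<lambda>j. w (inv_into I \<rho> j)))"
proof -
  have inv: "inv_into I \<rho> j \<in> I" if "j \<in> J" for j
    using \<rho> that by (metis bij_betw_def inv_into_into)
  have inv2: "\<rho> i \<in> J" "inv_into I \<rho> (\<rho> i) = i" if "i \<in> I" for i
    using \<rho> that by (auto simp: bij_betw_def)
  show ?thesis
    unfolding grid_mono_def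
  proof (intro conjI allI impI)
    fix u v :: "nat \<Rightarrow> nat" assume "\<forall>i\<in>I. u i = v i"
    then show "g (\<lambda>j. u (inv_into I \<rho> j)) = g (\<lambda>j. v (inv_into I \<rho> j))"
      using inv by (intro grid_mono_cong[OF gm]) simp
  next
    fix u v :: "nat \<Rightarrow> nat" assume uv: "(\<forall>i\<in>I. u i \<le> v i \<and> v i < N) \<and> (\<exists>i\<in>I. u i < v i)"
    then obtain i where i: "i \<in> I" "u i < v i" by blast
    show "g (\<lambda>j. u (inv_into I \<rho> j)) < g (\<lambda>j. v (inv_into I \<rho> j))"
      by (rule grid_mono_less[OF gm _ _ inv2(1)[OF i(1)]]) (use uv inv inv2 i in auto)
  qed
qed

text \<open>
  Coordinates are sorted by rank, the highest index being the most significant. If \<open>x\<close> and \<open>y\<close> differ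
  in coordinate \<open>i\<close> and in none above it, the coordinates below \<open>i\<close> are reset to their minimum one
  after the other, each time paying with one step along the chain \<open>z i\<close>. Keeping only every \<open>d\<close>-th
  element of the chain leaves enough steps between \<open>x i\<close> and \<open>y i\<close>.
\<close>

lemma lex_of_dominating_chains:
  fixes G :: "(nat \<Rightarrow> nat) \<Rightarrow> real"
  assumes gm: "grid_mono {..<d} (2 * q ^ d) G" and d: "d \<ge> 1" and n: "1 \<le> n" "n \<le> q"
    and z_const: "\<And>l. z 0 l = z 0 0"
    and z_step: "\<And>r l. 0 < r \<Longrightarrow> r < d \<Longrightarrow> Suc l < d * n \<Longrightarrow> z r l + q ^ r \<le> z r (Suc l)"
    and z_range: "\<And>r l. r < d \<Longrightarrow> l < d * n \<Longrightarrow> z r l < z r 0 + q ^ (r + 1)"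
    and z_less: "\<And>r l. r < d \<Longrightarrow> l < d * n \<Longrightarrow> z r l < q ^ d"
    and dom: "\<And>a r r'. (\<And>r. r < d \<Longrightarrow> \<exists>l<d * n. a r = z r l) \<Longrightarrow> r < r' \<Longrightarrow> r' < d \<Longrightarrow>
       G (a(r := a r + q ^ (r + 1))) \<le> G (a(r' := a r' + q ^ r'))"
  shows "\<exists>Y. (\<forall>r<d. Y r \<subseteq> {..<2 * q ^ d} \<and> card (Y r) = n) \<and>
     (\<forall>x y i. (\<forall>r<d. x r \<in> Y r \<and> y r \<in> Y r) \<and> i < d \<and> x i < y i \<and> (\<forall>r. i < r \<and> r < d \<longrightarrow> x r = y r)
        \<longrightarrow> G x < G y)"
proof -
  \<comment> \<open>Rank 0 may use \<open>n\<close> consecutive integers: they span less than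
    \<open>q\<close>, the step length for which rank 0 is dominated by all higher ranks.\<close>
  define Y where "Y r = (if r = 0 then {z 0 0..<z 0 0 + n} else (\<lambda>k. z r (d * k)) ` {..<n})" for r
  have dk: "d * k + t < d * n" if "k < n" "t < d" for k t
  proof -
    have "d * (k + 1) \<le> d * n" using that by (intro mult_le_mono2) simp
    then show ?thesis using that by simp
  qed
  have "d * 0 + 0 < d * n" by (rule dk) (use n d in auto)
  then have dn: "0 < d * n" by simp
  have q: "q \<ge> 1" using n by simp
  have qpow: "q ^ (r + 1) \<le> q ^ d" if "r < d" for r using that q by (intro power_increasing) auto
  have z_mono: "z r l < z r l'" if r: "0 < r" "r < d" and l: "l < l'" "l' < d * n" for r l l'
    using l
  proof (induction l')
    case (Suc l')
    have "z r l' + q ^ r \<le> z r (Suc l')" using Suc.prems by (intro z_step r) auto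
    moreover have "q ^ r > 0" using q by simp
    ultimately have "z r l' < z r (Suc l')" by linarith
    then show ?case using Suc by (cases "l = l'") auto
  qed simp
  have z_ge: "z r 0 \<le> z r l" if "r < d" "l < d * n" for r l
    using z_mono[of r 0 l] z_const[of l] that by (cases "r = 0"; cases "l = 0") auto
  have Y_z: "\<exists>k<n. a = z r (d * k)" if "a \<in> Y r" "0 < r" for r a
    using that by (auto simp: Y_def)
  have Y0: "z 0 0 \<le> a" "a < z 0 0 + q" if "a \<in> Y 0" for a using that n by (auto simp: Y_def)
  have Y_range: "z r 0 \<le> a \<and> a < z r 0 + q ^ (r + 1)" if a: "a \<in> Y r" and r: "r < d" for r a
  proof (cases "r = 0")
    case False
    then obtain k where k: "k < n" "a = z r (d * k)" using Y_z[OF a] by auto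
    have "d * k < d * n" using dk[of k 0] k d by simp
    then show ?thesis using z_range[OF r, of "d * k"] z_ge[OF r, of "d * k"] k by simp
  qed (use Y0[of a] a in simp)
  have Y_less: "a < 2 * q ^ d" if "a \<in> Y r" "r < d" for r a
    using Y_range[OF that] z_less[OF that(2) dn] qpow[OF that(2)] by linarith
  have "card (Y r) = n" if "r < d" for r
  proof (cases "r = 0")
    case False
    have "inj_on (\<lambda>k. z r (d * k)) {..<n}"
    proof (rule linorder_inj_onI)
      fix k k' assume k: "k < k'" "k' \<in> {..<n}"
      have "d * k < d * k'" using k d by simp
      moreover have "d * k' < d * n" using k d by simp
      ultimately show "z r (d * k) \<noteq> z r (d * k')" using z_mono[of r "d * k" "d * k'"] False that by simp
    qed auto
    then show ?thesis using False by (simp add: Y_def card_image)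
  qed (simp add: Y_def)
  moreover have "G x < G y"
    if xy: "\<forall>r<d. x r \<in> Y r \<and> y r \<in> Y r" and i: "i < d" "x i < y i" and eq: "\<forall>r. i < r \<and> r < d \<longrightarrow> x r = y r"
    for x y i
  proof (cases "i = 0")
    case True
    then show ?thesis
      by (intro grid_mono_less[OF gm, where j = i])
        (use xy i eq Y_less in \<open>auto, metis not_gr_zero order_refl less_imp_le\<close>)
  next
    case False
    obtain k where k: "k < n" "x i = z i (d * k)" using Y_z[of "x i" i] xy i False by auto
    obtain k' where k': "k' < n" "y i = z i (d * k')" using Y_z[of "y i" i] xy i False by auto
    have "k < k'"
    proof (rule ccontr)
      assume "\<not> k < k'"
      then have "k' = k \<or> d * k' < d * k" using d by auto
      then have "z i (d * k') \<le> z i (d * k)" using z_mono[of i "d * k'" "d * k"] dk[of k 0] k False i d by auto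
      then show False using i k k' by simp
    qed
    \<comment> \<open>After \<open>t\<close> rounds the coordinates below \<open>t\<close> are at
      their minimum, and coordinate \<open>i\<close> has advanced \<open>t\<close> places along its
      chain.\<close>
    define a where "a t = (\<lambda>r. if r = i then z i (d * k + t) else if r < t then z r 0 else x r)" for t
    have step: "G (a t) \<le> G (a (Suc t))" if t: "t < i" for t
    proof -
      \<comment> \<open>The point \<open>b\<close> lies on the chains in every coordinate, as
        \<open>dom\<close> requires. A step of length \<open>q ^ (t + 1)\<close> from
        \<open>b\<close> in coordinate \<open>t\<close> covers \<open>a t\<close>, while a step of
        length \<open>q ^ i\<close> in coordinate \<open>i\<close> stays below
        \<open>a (Suc t)\<close>.\<close>
      define b where "b = (a t)(t := z t 0)"
      have ti: "t < d" "t \<noteq> i" using t i by auto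
      have base: "\<exists>l<d * n. b r = z r l" if rd: "r < d" for r
      proof -
        consider "r = i" | "r \<noteq> i" "r \<le> t" | "r \<noteq> i" "r > t" by linarith
        then show ?thesis
        proof cases
          case 1
          then show ?thesis using dk[OF k(1), of t] ti by (auto simp: b_def a_def)
        next
          case 2
          then show ?thesis using dn by (intro exI[of _ 0]) (auto simp: b_def a_def)
        next
          case 3
          then obtain l where "l < n" "x r = z r (d * l)" using Y_z[of "x r" r] xy rd by auto
          then show ?thesis using 3 dk[of l 0] d by (intro exI[of _ "d * l"]) (auto simp: b_def a_def)
        qed
      qed
      have b_less: "b r < q ^ d" if "r < d" for r using base[OF that] z_less[OF that] by auto
      have "G (a t) \<le> G (b(t := b t + q ^ (t + 1)))"
      proof (rule grid_mono_le[OF gm])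
        fix r assume r: "r \<in> {..<d}"
        have "x t < z t 0 + q ^ (t + 1)" using Y_range[of "x t" t] xy ti by blast
        then show "a t r \<le> (b(t := b t + q ^ (t + 1))) r" using ti by (auto simp: b_def a_def)
        show "(b(t := b t + q ^ (t + 1))) r < 2 * q ^ d"
          using b_less[of r] b_less[of t] qpow[of t] r ti by auto
      qed
      also have "\<dots> \<le> G (b(i := b i + q ^ i))" by (rule dom[OF base t i(1)])
      also have "\<dots> \<le> G (a (Suc t))"
      proof (rule grid_mono_le[OF gm])
        fix r assume r: "r \<in> {..<d}"
        have l: "d * k + Suc t < d * n" using dk[OF k(1), of "Suc t"] t i by simp
        then have "z i (d * k + t) + q ^ i \<le> z i (d * k + Suc t)"
          using z_step[of i "d * k + t"] False i by simp
        then show "(b(i := b i + q ^ i)) r \<le> a (Suc t) r"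
          using ti by (auto simp: b_def a_def)
        show "a (Suc t) r < 2 * q ^ d"
          using z_less[OF _ l, of i] z_less[OF _ dn, of r] Y_less[of "x r" r] xy r i by (auto simp: a_def)
      qed
      finally show ?thesis .
    qed
    have "a 0 = x" using k by (auto simp: a_def fun_eq_iff)
    have "t \<le> i \<Longrightarrow> G x \<le> G (a t)" for t
    proof (induction t)
      case (Suc t)
      then show ?case using step[of t] by simp
    qed (simp add: \<open>a 0 = x\<close>)
    then have "G x \<le> G (a i)" by simp
    also have "\<dots> < G y"
    proof (rule grid_mono_less[OF gm, where j = i])
      \<comment> \<open>The \<open>i < d\<close> rounds do not exhaust the gap of \<open>d\<close>
        chain places between consecutive values kept in \<open>Y i\<close>.\<close>
      have "d * (k + 1) \<le> d * k'" using \<open>k < k'\<close> by (intro mult_le_mono2) simp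
      then have "d * k + i < d * k'" using i by simp
      moreover have "d * k' < d * n" using dk[OF k'(1), of 0] d by simp
      ultimately show less: "a i i < y i" using z_mono[of i "d * k + i" "d * k'"] False i k' by (simp add: a_def)
      show "a i r \<le> y r" if "r \<in> {..<d}" for r
      proof -
        consider "r = i" | "r < i" | "r > i" by linarith
        then show ?thesis
        proof cases
          case 2
          then show ?thesis using Y_range[of "y r" r] xy that by (simp add: a_def)
        next
          case 3
          then show ?thesis using eq that by (simp add: a_def)
        qed (use less in simp)
      qed
    qed (use i Y_less xy in auto)
    finally show ?thesis .
  qed
  ultimately show ?thesis using Y_less by (intro exI[of _ Y]) blast
qed

lemma popular_class:
  assumes "finite A" "finite B" "c ` A \<subseteq> B" "B \<noteq> {}"
  shows "\<exists>b\<in>B. card A \<le> card B * card {a \<in> A. c a = b}"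
proof -
  have "card A = (\<Sum>b\<in>B. card {a \<in> A. c a = b})"
    using card_pairs_swap[OF assms(1,2), of "\<lambda>a b. c a = b"] assms(3) sum.cong[of A A "\<lambda>a. card {b \<in> B. c a = b}" "\<lambda>_. 1"]
    by (simp add: image_subset_iff Collect_conv_if2 cong: conj_cong)
  then have "1 * card A * card B \<le> (\<Sum>b\<in>B. card B * card {a \<in> A. c a = b})"
    by (simp add: sum_distrib_left[symmetric])
  then show ?thesis using popular_value[OF assms(2) _ assms(4), of "card A" "\<lambda>b. card B * card {a \<in> A. c a = b}"] by simp
qed

text \<open>Digits are indexed by pairs of a coordinate and a position, so that one box can vary
  digits of different coordinates.\<close>

definition digit_point :: "nat \<Rightarrow> nat \<Rightarrow> (nat \<times> nat \<Rightarrow> nat) \<Rightarrow> nat \<Rightarrow> nat" where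
  "digit_point d q t j = (\<Sum>r<d. t (j, r) * q ^ r)"

text \<open>Rank 0 is the least significant. Taking \<open>\<rho>\<close> extensional leaves at most
  \<open>d ^ d\<close> candidates for the pigeonhole argument.\<close>

definition ranked :: "nat \<Rightarrow> nat \<Rightarrow> ((nat \<Rightarrow> nat) \<Rightarrow> real) \<Rightarrow> (nat \<Rightarrow> nat) \<Rightarrow> (nat \<Rightarrow> nat) \<Rightarrow> bool" where
  "ranked d q g a \<rho> \<longleftrightarrow> \<rho> \<in> {..<d} \<rightarrow>\<^sub>E {1..d} \<and> bij_betw \<rho> {..<d} {1..d} \<and>
     (\<forall>r r'. r < r' \<and> r' < d \<longrightarrow>
        g (a(\<rho> r := a (\<rho> r) + q ^ (r + 1))) \<le> g (a(\<rho> r' := a (\<rho> r') + q ^ r')))"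

text \<open>\<open>greedy_order\<close> is applied to the values reached by steps of length
  \<open>q ^ l\<close>. The side \<open>2 * q ^ d\<close> leaves room for all of them, as
  \<open>a j\<close> and the step contribute at most \<open>q ^ d\<close> each.\<close>

lemma ranked_exists:
  assumes gm: "grid_mono {1..d} (2 * q ^ d) g" and q: "q \<ge> 1" and a: "\<And>j. j \<in> {1..d} \<Longrightarrow> a j < q ^ d"
  shows "\<exists>\<rho>. ranked d q g a \<rho>"
proof -
  define v where "v j l = g (a(j := a j + q ^ l))" for j l
  have "\<exists>\<rho>. bij_betw \<rho> {..<d} {1..d} \<and>
     (\<forall>r r'. r < r' \<and> r' < d \<longrightarrow> v (\<rho> r) (0 + r + 1) \<le> v (\<rho> r') (0 + r'))"
  proof (rule greedy_order)
    show "v j l \<le> v j l'" if j: "j \<in> {1..d}" and l: "l \<le> l'" "l' \<le> 0 + d" for j l l'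
      unfolding v_def
    proof (rule grid_mono_le[OF gm])
      fix i assume i: "i \<in> {1..d}"
      have le: "q ^ l \<le> q ^ l'" "q ^ l' \<le> q ^ d" using q l by (auto intro!: power_increasing)
      then show "(a(j := a j + q ^ l)) i \<le> (a(j := a j + q ^ l')) i" by simp
      show "(a(j := a j + q ^ l')) i < 2 * q ^ d" using a[OF i] a[OF j] le by auto
    qed
  qed auto
  then obtain \<rho> where \<rho>: "bij_betw \<rho> {..<d} {1..d}"
    and order: "\<And>r r'. r < r' \<Longrightarrow> r' < d \<Longrightarrow> v (\<rho> r) (r + 1) \<le> v (\<rho> r') r'"
    by auto
  have "bij_betw (restrict \<rho> {..<d}) {..<d} {1..d}"
    using \<rho> bij_betw_cong[of "{..<d}" "restrict \<rho> {..<d}" \<rho> "{1..d}"] by simp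
  moreover have "restrict \<rho> {..<d} \<in> {..<d} \<rightarrow>\<^sub>E {1..d}" using \<rho> by (auto simp: bij_betw_def)
  ultimately have "ranked d q g a (restrict \<rho> {..<d})"
    unfolding ranked_def using order by (auto simp: v_def)
  then show ?thesis by blast
qed

lemma grid_forces_general:
  assumes d: "d \<ge> 1" and n: "1 \<le> n" "n \<le> q"
    and q: "\<And>i. i < d - 1 \<Longrightarrow> 4 * box_const (d * n) i (d ^ d) * (d * n) \<le> q"
  shows "grid_forces d n (2 * q ^ d)"
  unfolding grid_forces_def
proof (intro allI impI, elim conjE)
  fix g :: "(nat \<Rightarrow> nat) \<Rightarrow> real"
  assume gm: "grid_mono {1..d} (2 * q ^ d) g"
  define I where "I = {1..d} \<times> {..<d}"
  define m where "m = d * n"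
  define \<Omega> where "\<Omega> = I \<rightarrow>\<^sub>E {..<q}"
  have q1: "q \<ge> 1" using n by simp
  have pt_less: "digit_point d q t j < q ^ d" if "t \<in> \<Omega>" "j \<in> {1..d}" for t j
    unfolding digit_point_def
    by (rule digit_sum_less) (use that in \<open>auto simp: \<Omega>_def I_def\<close>)
  define c where "c t = (SOME \<rho>. ranked d q g (digit_point d q t) \<rho>)" for t
  have c: "ranked d q g (digit_point d q t) (c t)" if "t \<in> \<Omega>" for t
    unfolding c_def
    by (rule someI_ex[where P = "ranked d q g (digit_point d q t)"], rule ranked_exists[OF gm q1])
      (use pt_less that in blast)
  have fin\<Omega>: "finite \<Omega>" "card \<Omega> = q ^ card I"
    unfolding \<Omega>_def I_def by (auto intro!: finite_PiE simp: card_PiE)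
  have "\<exists>\<rho>\<in>{..<d} \<rightarrow>\<^sub>E {1..d}. card \<Omega> \<le> card ({..<d} \<rightarrow>\<^sub>E {1..d}) * card {t \<in> \<Omega>. c t = \<rho>}"
  proof (rule popular_class[OF fin\<Omega>(1)])
    show "c ` \<Omega> \<subseteq> {..<d} \<rightarrow>\<^sub>E {1..d}" using c unfolding ranked_def by blast
  qed (use d in \<open>auto intro!: finite_PiE simp: PiE_eq_empty_iff\<close>)
  then obtain \<rho> where pop: "q ^ card I \<le> d ^ d * card {t \<in> \<Omega>. c t = \<rho>}"
    using fin\<Omega> by (auto simp: card_PiE)
  define S where "S = {t \<in> \<Omega>. c t = \<rho>}"
  have "q ^ card I > 0" using q1 by simp
  then have "card S > 0" using pop unfolding S_def by (intro gr0I) simp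
  then obtain t0 where "t0 \<in> S" by (metis card_gt_0_iff ex_in_conv)
  then have \<rho>: "bij_betw \<rho> {..<d} {1..d}" using c unfolding S_def ranked_def by blast
  have \<rho>_in: "\<rho> r \<in> {1..d}" if "r < d" for r using \<rho> that by (auto simp: bij_betw_def)
  have \<rho>_inj: "\<rho> r = \<rho> r' \<longleftrightarrow> r = r'" if "r < d" "r' < d" for r r'
    using \<rho> that by (auto simp: bij_betw_def inj_on_def)

  \<comment> \<open>The varying digits: position \<open>r\<close> of the coordinate of rank
    \<open>r\<close>, for \<open>r \<ge> 1\<close>. Such a digit moves its coordinate in multiples
    of \<open>q ^ r\<close> over a range below \<open>q ^ (r + 1)\<close>, which matches the two
    step lengths in \<open>ranked\<close>.\<close>
  define K where "K = (\<lambda>r. (\<rho> r, r)) ` {1..<d}"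
  define R where "R = I - K"
  have KI: "K \<subseteq> I" using \<rho>_in by (force simp: K_def I_def)
  then have KR: "K \<union> R = I" "K \<inter> R = {}" by (auto simp: R_def)
  have cardK: "card K = d - 1" unfolding K_def by (subst card_image) (auto simp: inj_on_def)
  have "\<exists>X u. (\<forall>k\<in>K. X k \<subseteq> {..<q} \<and> card (X k) = m) \<and> (\<forall>r\<in>R. u r < q) \<and>
     (\<forall>w\<in>extensional (K \<union> R). (\<forall>k\<in>K. w k \<in> X k) \<and> (\<forall>r\<in>R. w r = u r) \<longrightarrow> w \<in> S)"
  proof (rule dense_contains_box)
    show "finite K" "finite R" by (auto simp: K_def R_def I_def)
    show "S \<subseteq> K \<union> R \<rightarrow>\<^sub>E {..<q}" unfolding KR by (auto simp: S_def \<Omega>_def)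
    show "q ^ card (K \<union> R) \<le> d ^ d * card S" unfolding KR S_def by (rule pop)
    show "4 * box_const m i (d ^ d) * m \<le> q" if "i < card K" for i
      using q[of i] that unfolding cardK m_def .
  qed (use KR q1 d in auto)
  then obtain X u where X: "\<And>k. k \<in> K \<Longrightarrow> X k \<subseteq> {..<q} \<and> card (X k) = m"
    and u: "\<And>k. k \<in> R \<Longrightarrow> u k < q"
    and w: "\<And>w. w \<in> extensional I \<Longrightarrow> \<forall>k\<in>K. w k \<in> X k \<Longrightarrow> \<forall>k\<in>R. w k = u k \<Longrightarrow> w \<in> S"
    unfolding KR by blast
  have "\<exists>e. bij_betw e {..<m} (X (\<rho> r, r)) \<and> strict_mono_on {..<m} e" if "r \<in> {1..<d}" for r
  proof -
    have "(\<rho> r, r) \<in> K" using that by (auto simp: K_def)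
    from X[OF this] have "finite (X (\<rho> r, r))" "card (X (\<rho> r, r)) = m"
      by (auto intro: finite_subset)
    then show ?thesis using bij_betw_strict_mono_finite[of "X (\<rho> r, r)"] by metis
  qed
  then obtain e where e: "\<And>r. r \<in> {1..<d} \<Longrightarrow> bij_betw (e r) {..<m} (X (\<rho> r, r))"
    and e_mono: "\<And>r. r \<in> {1..<d} \<Longrightarrow> strict_mono_on {..<m} (e r)"
    by metis
  have e_less: "e r l < q" if "r \<in> {1..<d}" "l < m" for r l
  proof -
    have "e r l \<in> X (\<rho> r, r)" using e that by (auto simp: bij_betw_def)
    moreover have "(\<rho> r, r) \<in> K" using that by (auto simp: K_def)
    ultimately show ?thesis using X[of "(\<rho> r, r)"] by auto
  qed
  \<comment> \<open>The argument \<open>l\<close> selects, for each rank \<open>r\<close>, the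
    \<open>l r\<close>-th smallest admissible value of the varying digit; all other digits are
    frozen.\<close>
  define dig where "dig l = (\<lambda>(j, r)\<in>I. if (j, r) \<in> K then e r (l r) else u (j, r))" for l :: "nat \<Rightarrow> nat"
  have dig_S: "dig l \<in> S" if "\<And>r. r \<in> {1..<d} \<Longrightarrow> l r < m" for l
  proof (rule w)
    show "\<forall>k\<in>K. dig l k \<in> X k"
    proof
      fix k assume k: "k \<in> K"
      then obtain r where r: "r \<in> {1..<d}" "k = (\<rho> r, r)" unfolding K_def by blast
      have "e r (l r) \<in> X (\<rho> r, r)" using bij_betwE[OF e[OF r(1)]] that[OF r(1)] by simp
      then show "dig l k \<in> X k" using k KI r by (auto simp: dig_def)
    qed
    show "\<forall>k\<in>R. dig l k = u k" by (auto simp: dig_def R_def)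
  qed (simp add: dig_def)
  define z where "z r l = digit_point d q (dig (\<lambda>_. l)) (\<rho> r)" for r l
  \<comment> \<open>Each coordinate contains at most one varying digit, so its value depends on
    \<open>l r\<close> only.\<close>
  have z_eq: "digit_point d q (dig l) (\<rho> r) = z r (l r)" if "r < d" for l r
    unfolding z_def digit_point_def
  proof (rule sum.cong[OF refl])
    fix s assume "s \<in> {..<d}"
    then have "(\<rho> r, s) \<in> K \<longrightarrow> s = r" using \<rho>_inj that by (auto simp: K_def)
    then show "dig l (\<rho> r, s) * q ^ s = dig (\<lambda>_. l r) (\<rho> r, s) * q ^ s"
      by (auto simp: dig_def)
  qed
  have z_split: "\<exists>b. \<forall>l. z r l = b + e r l * q ^ r" if r: "r \<in> {1..<d}" for r
  proof -
    have K: "(\<rho> r, r) \<in> K" "(\<rho> r, r) \<in> I" using r \<rho>_in by (auto simp: K_def I_def)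
    have nK: "(\<rho> r, s) \<notin> K" if "s \<noteq> r" "s < d" for s using \<rho>_inj that r by (auto simp: K_def)
    have "z r l = (\<Sum>s\<in>{..<d} - {r}. dig (\<lambda>_. 0) (\<rho> r, s) * q ^ s) + e r l * q ^ r" for l
    proof -
      have "z r l = dig (\<lambda>_. l) (\<rho> r, r) * q ^ r + (\<Sum>s\<in>{..<d} - {r}. dig (\<lambda>_. l) (\<rho> r, s) * q ^ s)"
        unfolding z_def digit_point_def using r by (subst sum.remove[of _ r]) auto
      moreover have "(\<Sum>s\<in>{..<d} - {r}. dig (\<lambda>_. l) (\<rho> r, s) * q ^ s) =
          (\<Sum>s\<in>{..<d} - {r}. dig (\<lambda>_. 0) (\<rho> r, s) * q ^ s)"
        by (rule sum.cong) (use nK in \<open>auto simp: dig_def\<close>)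
      moreover have "dig (\<lambda>_. l) (\<rho> r, r) = e r l" using K by (simp add: dig_def)
      ultimately show ?thesis by simp
    qed
    then show ?thesis by blast
  qed
  define rk where "rk = inv_into {..<d} \<rho>"
  have rk: "rk (\<rho> r) = r" if "r < d" for r
    unfolding rk_def using \<rho> that by (simp add: bij_betw_def)
  have \<rho>rk: "\<rho> (rk j) = j" "rk j < d" if "j \<in> {1..d}" for j
    unfolding rk_def
    using bij_betw_inv_into_right[OF \<rho> that] bij_betwE[OF bij_betw_inv_into[OF \<rho>]] that by auto
  define G where "G w = g (\<lambda>j. w (rk j))" for w
  have dep: "g x = g y" if "\<And>j. j \<in> {1..d} \<Longrightarrow> x j = y j" for x y
    using gm that unfolding grid_mono_def by blast
  have z_const: "z 0 l = z 0 0" for l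
    unfolding z_def digit_point_def
  proof (rule sum.cong[OF refl])
    fix s assume "s \<in> {..<d}"
    then have "(\<rho> 0, s) \<notin> K" using \<rho>_inj[of 0 s] d by (auto simp: K_def)
    then show "dig (\<lambda>_. l) (\<rho> 0, s) * q ^ s = dig (\<lambda>_. 0) (\<rho> 0, s) * q ^ s" by (simp add: dig_def)
  qed
  have "\<exists>Y. (\<forall>r<d. Y r \<subseteq> {..<2 * q ^ d} \<and> card (Y r) = n) \<and>
     (\<forall>x y i. (\<forall>r<d. x r \<in> Y r \<and> y r \<in> Y r) \<and> i < d \<and> x i < y i \<and> (\<forall>r. i < r \<and> r < d \<longrightarrow> x r = y r)
        \<longrightarrow> G x < G y)"
  proof (rule lex_of_dominating_chains[OF _ d n, where z = z])
    show "grid_mono {..<d} (2 * q ^ d) G"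
      using grid_mono_reindex[OF gm \<rho>] unfolding G_def rk_def .
    show "z 0 l = z 0 0" for l by (rule z_const)
    show "z r l + q ^ r \<le> z r (Suc l)" if r: "0 < r" "r < d" and l: "Suc l < d * n" for r l
    proof -
      have r': "r \<in> {1..<d}" using r by simp
      obtain b where b: "\<And>l. z r l = b + e r l * q ^ r" using z_split[OF r'] by blast
      have "e r l < e r (Suc l)" using strict_mono_onD[OF e_mono[OF r'], of l "Suc l"] l by (simp add: m_def)
      then have "(e r l + 1) * q ^ r \<le> e r (Suc l) * q ^ r" by (intro mult_le_mono1) simp
      then show ?thesis by (simp add: b)
    qed
    show "z r l < z r 0 + q ^ (r + 1)" if r: "r < d" and l: "l < d * n" for r l
    proof (cases "r = 0")
      case True
      then show ?thesis using z_const[of l] q1 by simp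
    next
      case False
      then have r': "r \<in> {1..<d}" using r by simp
      obtain b where b: "\<And>l. z r l = b + e r l * q ^ r" using z_split[OF r'] by blast
      have "e r l * q ^ r < q ^ (r + 1)" using e_less[OF r', of l] l q1 by (simp add: m_def)
      then show ?thesis unfolding b by linarith
    qed
    show "z r l < q ^ d" if "r < d" "l < d * n" for r l
      unfolding z_def by (rule pt_less[OF _ \<rho>_in]) (use dig_S[of "\<lambda>_. l"] that in \<open>auto simp: S_def m_def\<close>)
    show "G (a(r := a r + q ^ (r + 1))) \<le> G (a(r' := a r' + q ^ r'))"
      if a: "\<And>r. r < d \<Longrightarrow> \<exists>l<d * n. a r = z r l" and r: "r < r'" "r' < d" for a r r'
    proof -
      \<comment> \<open>Since \<open>a\<close> lies on the chains, it comes from a digit assignment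
        in the box; that assignment is in \<open>S\<close>, so its ranking is
        \<open>\<rho>\<close>.\<close>
      obtain l where l: "\<And>r. r < d \<Longrightarrow> l r < m \<and> a r = z r (l r)" using a unfolding m_def by metis
      define t where "t = dig l"
      have "t \<in> S" unfolding t_def by (rule dig_S) (use l in simp)
      have pt: "digit_point d q t (\<rho> s) = a s" if "s < d" for s
        unfolding t_def z_eq[OF that] using l[OF that] by simp
      have G_upd: "G (a(s := x)) = g ((digit_point d q t)(\<rho> s := x))" if "s < d" for s x
        unfolding G_def
      proof (rule dep)
        fix j assume j: "j \<in> {1..d}"
        show "(a(s := x)) (rk j) = ((digit_point d q t)(\<rho> s := x)) j"
          using pt[OF \<rho>rk(2)[OF j]] \<rho>rk[OF j] rk[OF that] by auto
      qed
      have "ranked d q g (digit_point d q t) \<rho>" using c[of t] \<open>t \<in> S\<close> unfolding S_def by auto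
      then have "g ((digit_point d q t)(\<rho> r := digit_point d q t (\<rho> r) + q ^ (r + 1))) \<le>
          g ((digit_point d q t)(\<rho> r' := digit_point d q t (\<rho> r') + q ^ r'))"
        using r unfolding ranked_def by blast
      then show ?thesis using r by (simp add: G_upd pt)
    qed
  qed
  then obtain Y where Y: "\<And>r. r < d \<Longrightarrow> Y r \<subseteq> {..<2 * q ^ d} \<and> card (Y r) = n"
    and lex: "\<And>x y i. \<forall>r<d. x r \<in> Y r \<and> y r \<in> Y r \<Longrightarrow> i < d \<Longrightarrow> x i < y i \<Longrightarrow>
       \<forall>r. i < r \<and> r < d \<longrightarrow> x r = y r \<Longrightarrow> G x < G y"
    by blast
  \<comment> \<open>Ranks are reversed: \<open>lex_less\<close> compares position 1 first, whereas
    the highest rank is the most significant.\<close>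
  define \<sigma> where "\<sigma> p = (if p \<in> {1..d} then \<rho> (d - p) else p)" for p
  have "bij_betw (\<lambda>p. d - p) {1..d} {..<d}"
    by (rule bij_betw_byWitness[where f' = "\<lambda>r. d - r"]) auto
  then have "bij_betw (\<rho> \<circ> (\<lambda>p. d - p)) {1..d} {1..d}" using \<rho> bij_betw_trans by blast
  then have "bij_betw \<sigma> {1..d} {1..d}"
    using bij_betw_cong[of "{1..d}" \<sigma> "\<rho> \<circ> (\<lambda>p. d - p)" "{1..d}"] by (simp add: \<sigma>_def)
  then have "\<sigma> permutes {1..d}" by (rule bij_imp_permutes) (auto simp: \<sigma>_def)
  moreover have "g x < g y"
    if xy: "\<forall>j\<in>{1..d}. x j \<in> Y (rk j) \<and> y j \<in> Y (rk j)"
      and less: "lex_less d (\<lambda>i. x (\<sigma> i)) (\<lambda>i. y (\<sigma> i))" for x y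
  proof -
    obtain i where i: "i \<in> {1..d}" "x (\<sigma> i) < y (\<sigma> i)" "\<forall>j\<in>{1..<i}. x (\<sigma> j) = y (\<sigma> j)"
      using less unfolding lex_less_def by blast
    have G: "G (\<lambda>r. v (\<rho> r)) = g v" for v unfolding G_def by (rule dep) (simp add: \<rho>rk)
    have "G (\<lambda>r. x (\<rho> r)) < G (\<lambda>r. y (\<rho> r))"
    proof (rule lex[where i = "d - i"])
      show "\<forall>r<d. x (\<rho> r) \<in> Y r \<and> y (\<rho> r) \<in> Y r" using xy \<rho>_in rk by fastforce
      show "d - i < d" "x (\<rho> (d - i)) < y (\<rho> (d - i))" using i by (auto simp: \<sigma>_def)
      show "\<forall>r. d - i < r \<and> r < d \<longrightarrow> x (\<rho> r) = y (\<rho> r)"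
      proof (intro allI impI)
        fix r assume r: "d - i < r \<and> r < d"
        then have "d - r \<in> {1..<i}" "d - (d - r) = r" "d - r \<in> {1..d}" using i by auto
        then show "x (\<rho> r) = y (\<rho> r)" using i(3) by (metis \<sigma>_def)
      qed
    qed
    then show ?thesis unfolding G .
  qed
  ultimately show "\<exists>Y \<sigma>. \<sigma> permutes {1..d} \<and> (\<forall>i\<in>{1..d}. Y i \<subseteq> {..<2 * q ^ d} \<and> card (Y i) = n) \<and>
           (\<forall>x y. (\<forall>i\<in>{1..d}. x i \<in> Y i \<and> y i \<in> Y i) \<and>
              lex_less d (\<lambda>i. x (\<sigma> i)) (\<lambda>i. y (\<sigma> i)) \<longrightarrow> g x < g y)"
    using Y \<rho>rk by (intro exI[of _ "\<lambda>j. Y (rk j)"] exI[of _ \<sigma>]) blast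
qed

lemma general_bound:
  assumes "d \<ge> 1"
  shows "\<exists>c. \<forall>n\<ge>1. forces_lex_monotone d n (2 * (d * n * 2 ^ (c * (d * n + 2) ^ (d - 2))) ^ d)"
proof (intro exI allI impI)
  \<comment> \<open>Chosen such that \<open>4 * d ^ d \<le> 2 ^ c\<close>, where
    \<open>d ^ d\<close> is the inverse density of a popular ranking.\<close>
  define c where "c = 2 + d * d"
  show "forces_lex_monotone d n (2 * (d * n * 2 ^ (c * (d * n + 2) ^ (d - 2))) ^ d)"
    if n: "n \<ge> 1" for n
  proof (rule grid_forces_imp_forces_lex_monotone[OF grid_forces_general[OF assms n] n])
    have "1 * n \<le> d * n" "1 * (d * n) \<le> 2 ^ (c * (d * n + 2) ^ (d - 2)) * (d * n)"
      using assms by (intro mult_le_mono1; simp)+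
    then show "n \<le> d * n * 2 ^ (c * (d * n + 2) ^ (d - 2))"
      by (simp add: mult.commute)
    have "d ^ d \<le> (2 ^ d) ^ d" by (rule power_mono) (auto intro: less_imp_le)
    then have c4: "4 * d ^ d \<le> 2 ^ c" by (simp add: c_def power_add power_mult)
    show "4 * box_const (d * n) i (d ^ d) * (d * n) \<le> d * n * 2 ^ (c * (d * n + 2) ^ (d - 2))"
      if i: "i < d - 1" for i
    proof -
      have "4 * box_const (d * n) i (d ^ d) \<le> 2 ^ (c * (d * n + 2) ^ i)"
        by (rule box_const_le[OF c4]) (simp add: c_def)
      \<comment> \<open>With \<open>d - 1\<close> varying digits the largest index is
        \<open>i = d - 2\<close>; this fixes the exponent.\<close>
      also have "\<dots> \<le> 2 ^ (c * (d * n + 2) ^ (d - 2))"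
        using i by (intro power_increasing mult_le_mono2) auto
      finally show ?thesis by (simp add: mult.commute)
    qed
  qed
qed

section \<open>The exact value and the exponential bound for \<open>F\<close>\<close>

lemma F_le: "N \<ge> 1 \<Longrightarrow> forces_lex_monotone d n N \<Longrightarrow> F d n \<le> N"
  unfolding F_def by (rule Least_le) simp

lemma F_2_eq:
  assumes "n \<ge> 1"
  shows "int (F 2 n) = 2 * (int n)\<^sup>2 - 5 * int n + 4"
proof -
  define N where "N = (n - 1) * (2 * n - 3) + 1"
  have N: "int N = 2 * (int n)\<^sup>2 - 5 * int n + 4"
  proof (cases "n = 1")
    case False
    then obtain k where "n = k + 2" using assms by (metis add.commute le_Suc_ex nat_1_add_1 le_antisym not_less_eq_eq One_nat_def Suc_1)
    then show ?thesis by (simp add: N_def power2_eq_square algebra_simps)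
  qed (simp add: N_def)
  have "F 2 n = N"
    unfolding F_def
  proof (rule Least_equality)
    show "N \<ge> 1 \<and> forces_lex_monotone 2 n N"
      using grid_forces_imp_forces_lex_monotone[OF grid_forces_2[OF assms] assms] by (simp add: N_def)
    show "N \<le> M" if M: "M \<ge> 1 \<and> forces_lex_monotone 2 n M" for M
    proof (rule ccontr)
      assume "\<not> N \<le> M"
      then have "M \<le> (n - 1) * (2 * n - 3)" by (simp add: N_def)
      \<comment> \<open>For \<open>n = 1\<close> the claimed value is 1, and no positive
        \<open>M\<close> is smaller.\<close>
      moreover have "n \<noteq> 1" using M \<open>\<not> N \<le> M\<close> by (auto simp: N_def)
      moreover have "int ((n - 1) * (2 * n - 3)) = int (n - 1) * (2 * int (n - 1) - 1)"
        using assms \<open>n \<noteq> 1\<close> by (simp add: of_nat_diff)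
      ultimately have "int M \<le> int (n - 1) * (2 * int (n - 1) - 1)" by linarith
      moreover have "n - 1 \<ge> 1" using assms \<open>n \<noteq> 1\<close> by simp
      ultimately have "\<not> forces_lex_monotone 2 (n - 1 + 1) M" using M not_forces_2 by blast
      then show False using M assms by simp
    qed
  qed
  then show ?thesis using N by simp
qed

lemma F_le_exp:
  assumes d: "d \<ge> 3"
  shows "\<exists>C::real. \<forall>n\<ge>1. real (F d n) \<le> 2 powr (C * real n ^ (d - 2))"
proof -
  have "d \<ge> 1" using d by simp
  from general_bound[OF this] obtain c where forces:
    "\<And>n. n \<ge> 1 \<Longrightarrow> forces_lex_monotone d n (2 * (d * n * 2 ^ (c * (d * n + 2) ^ (d - 2))) ^ d)"
    by blast
  \<comment> \<open>The bracket is the exponent of \<open>q\<close> per unit of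
    \<open>n ^ (d - 2)\<close>; it is multiplied by \<open>d\<close> for the power
    \<open>q ^ d\<close>, and the summand 1 absorbs the factor 2.\<close>
  define C where "C = 1 + (d + c * (d + 2) ^ (d - 2)) * d"
  have "real (F d n) \<le> 2 powr (real C * real n ^ (d - 2))" if n: "n \<ge> 1" for n
  proof -
    define p where "p = n ^ (d - 2)"
    \<comment> \<open>Here \<open>d \<ge> 3\<close> enters: \<open>n \<le> n ^ (d - 2)\<close> lets
      the factor \<open>d * n\<close> of \<open>q\<close> disappear in the exponential.\<close>
    have p: "1 \<le> p" "n \<le> p"
      unfolding p_def using n d self_le_power[of n "d - 2"] by auto
    define q where "q = d * n * 2 ^ (c * (d * n + 2) ^ (d - 2))"
    have "q \<ge> 1" using n d by (simp add: q_def)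
    have "d * n \<le> 2 ^ (d * p)"
    proof -
      have "d * n \<le> d * p" using p by simp
      also have "\<dots> \<le> 2 ^ (d * p)" by (rule less_imp_le) (rule less_exp)
      finally show ?thesis .
    qed
    moreover have "(2::nat) ^ (c * (d * n + 2) ^ (d - 2)) \<le> 2 ^ (c * ((d + 2) ^ (d - 2) * p))"
    proof (intro power_increasing mult_le_mono2)
      have "d * n + 2 \<le> (d + 2) * n" using n by (simp add: algebra_simps)
      then have "(d * n + 2) ^ (d - 2) \<le> ((d + 2) * n) ^ (d - 2)" by (rule power_mono) simp
      then show "(d * n + 2) ^ (d - 2) \<le> (d + 2) ^ (d - 2) * p" by (simp only: p_def power_mult_distrib)
    qed simp
    ultimately have "q \<le> 2 ^ (d * p) * 2 ^ (c * ((d + 2) ^ (d - 2) * p))"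
      unfolding q_def by (rule mult_le_mono)
    also have "\<dots> = 2 ^ ((d + c * (d + 2) ^ (d - 2)) * p)"
      by (simp add: power_add[symmetric] algebra_simps)
    finally have q: "q \<le> 2 ^ ((d + c * (d + 2) ^ (d - 2)) * p)" .
    have "F d n \<le> 2 * q ^ d"
      using forces[OF n] \<open>q \<ge> 1\<close> unfolding q_def by (intro F_le) auto
    also have "\<dots> \<le> 2 ^ p * (2 ^ ((d + c * (d + 2) ^ (d - 2)) * p)) ^ d"
      using p q power_increasing[of 1 p "2::nat"] by (intro mult_le_mono power_mono) auto
    also have "\<dots> = 2 ^ (C * p)"
      by (simp add: C_def power_add[symmetric] power_mult[symmetric] algebra_simps)
    finally have "real (F d n) \<le> real (2 ^ (C * p))" by (rule of_nat_mono)
    also have "\<dots> = 2 powr real (C * p)" by (subst powr_realpow) simp_all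
    also have "real (C * p) = real C * real n ^ (d - 2)" by (simp add: p_def)
    finally show ?thesis .
  qed
  then show ?thesis by blast
qed

theorem theorem1p2:
  shows "(\<forall>d\<ge>1. \<forall>n\<ge>1. \<exists>N\<ge>1. forces_lex_monotone d n N) \<and>
    (\<forall>n\<ge>1. int (F 2 n) = 2 * (int n)\<^sup>2 - 5 * int n + 4) \<and>
    (\<forall>d\<ge>3. \<exists>C::real. \<forall>n\<ge>1. real (F d n) \<le> 2 powr (C * real n ^ (d - 2)))"
proof (intro conjI allI impI)
  fix d n :: nat assume "d \<ge> 1" "n \<ge> 1"
  then obtain c where "forces_lex_monotone d n (2 * (d * n * 2 ^ (c * (d * n + 2) ^ (d - 2))) ^ d)"
    using general_bound[of d] by blast
  then show "\<exists>N\<ge>1. forces_lex_monotone d n N"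
    using \<open>d \<ge> 1\<close> \<open>n \<ge> 1\<close> by (intro exI conjI) (auto simp: Suc_le_eq)
qed (use F_2_eq F_le_exp in auto)

end
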